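(* Let $x,y\in\mathbb{Q}$ satisfy $0\le x<y\le 1$. (1) If $x$ and $y$ are of type (1) and $a\in\mathbb{Z}_{>0}$ satisfies $a\ge 2$, then $\mathcal{L}([\phi_{a,a+1}(G(x))])<\mathcal{L}([\phi_{a,a+1}(G(y))])$. (2) If $x$ and $y$ are of type (2) and $a\in\mathbb{Z}_{>0}$ satisfies $a\ge 1$, then $\mathcal{L}([\phi_{a,a+1}(G(x))])<\mathcal{L}([\phi_{a,a+1}(G(y))])$. (3) If $x$ and $y$ are of type (3) and $a\in\mathbb{Z}_{>0}$ satisfies $a\ge 2$, then $\mathcal{L}([\phi_{a,a+1}(G(x))])>\mathcal{L}([\phi_{a,a+1}(G(y))])$.
   Context: For an irrational real number $\alpha$, its Lagrange constant is $\mathcal{L}(\alpha)=\limsup_{q\to\infty}\frac{1}{q\,\Vert q\alpha\Vert}$, where $q$ ranges over positive integers and $\Vert t\Vert$ denotes the distance from $t$ to the nearest integer. For a rational number $x$ with $0\le x\le 1$, $G(x)=G(x,1)G(x,2)G(x,3)\cdots$ is the right-infinite word over $\{0,1\}$ with letters $G(x,n)=\lfloor nx\rfloor-\lfloor (n-1)x\rfloor$. For positive integers $a,b$, $\phi_{a,b}$ is the substitution $0\mapsto aa$, $1\mapsto bb$, applied letter by letter to words over $\{0,1\}$ (the images being concatenated). For a right-infinite word $w=w_1w_2w_3\cdots$ of positive integers, $[w]=[0;w_1,w_2,w_3,\ldots]$ denotes the value of the regular continued fraction with these partial quotients. For $u\in\mathbb{Q}$, $\mathrm{den}(u)\ge 1$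 denotes the denominator of $u$ in lowest terms. For rationals $0\le x<y\le 1$ the pair $x,y$ is said to be: - of type (1) if $(x,y)=(0,1)$, or there exists a positive integer $n$ with $n<\min(\mathrm{den}(x),\mathrm{den}(y))$ and $\lfloor nx\rfloor<\lfloor ny\rfloor$; - of type (2) if $\mathrm{den}(x)<\mathrm{den}(y)$ and $\lfloor jx\rfloor=\lfloor jy\rfloor$ for all $1\le j\le\mathrm{den}(x)$; - of type (3) if $\mathrm{den}(x)>\mathrm{den}(y)$, $\lfloor jx\rfloor=\lfloor jy\rfloor$ for all $1\le j<\mathrm{den}(y)$, and $\lfloor jx\rfloor<\lfloor jy\rfloor$ for $j=\mathrm{den}(y)$. *)

theory Defs
  imports "HOL-Analysis.Analysis" "HOL-Library.Stream"
begin

definition dist_nearest_int :: "real \<Rightarrow> real" where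
  "dist_nearest_int t = \<bar>t - of_int (round t)\<bar>"

text \<open>
  Meant for irrational \<open>\<alpha>\<close>. The values are extended reals because the upper limit is infinite
  for \<open>\<alpha>\<close> with unbounded partial quotients. The index \<open>q = 0\<close> is included but does not affect
  the upper limit.
\<close>
definition lagrange_const :: "real \<Rightarrow> ereal" where
  "lagrange_const \<alpha> = limsup (\<lambda>q::nat. ereal (1 / (real q * dist_nearest_int (real q * \<alpha>))))"

text \<open>
  Right-infinite words are streams. The \<open>n\<close>-th letter (counting from 1) of \<open>G_word x\<close> is the
  element at position \<open>n - 1\<close>, and it lies in \<open>{0, 1}\<close> whenever \<open>0 \<le> x \<le> 1\<close>.
\<close>
definition G_letter :: "rat \<Rightarrow> nat \<Rightarrow> int" where
  "G_letter x n = \<lfloor>of_nat n * x\<rfloor> - \<lfloor>(of_nat n - 1) * x\<rfloor>"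

definition G_word :: "rat \<Rightarrow> int stream" where
  "G_word x = smap (G_letter x) (fromN 1)"

text \<open>Only the letters 0 and 1 are relevant, so every nonzero letter is treated as 1.\<close>
definition phi_letter :: "nat \<Rightarrow> nat \<Rightarrow> int \<Rightarrow> nat list" where
  "phi_letter a b c = (if c = 0 then [a, a] else [b, b])"

definition phi :: "nat \<Rightarrow> nat \<Rightarrow> int stream \<Rightarrow> nat stream" where
  "phi a b w = flat (smap (phi_letter a b) w)"

text \<open>\<open>cf_list [w\<^sub>1, \<dots>, w\<^sub>n]\<close> is the finite continued fraction \<open>[0; w\<^sub>1, \<dots>, w\<^sub>n]\<close>.\<close>
fun cf_list :: "nat list \<Rightarrow> real" where
  "cf_list [] = 0"
| "cf_list (k # ks) = 1 / (real k + cf_list ks)"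

definition cf_value :: "nat stream \<Rightarrow> real" where
  "cf_value w = lim (\<lambda>n. cf_list (stake n w))"

definition den :: "rat \<Rightarrow> int" where
  "den u = snd (quotient_of u)"

definition pair_type1 :: "rat \<Rightarrow> rat \<Rightarrow> bool" where
  "pair_type1 x y \<longleftrightarrow>
     (x, y) = (0, 1) \<or>
     (\<exists>n::int. 0 < n \<and> n < min (den x) (den y) \<and> \<lfloor>of_int n * x\<rfloor> < \<lfloor>of_int n * y\<rfloor>)"

definition pair_type2 :: "rat \<Rightarrow> rat \<Rightarrow> bool" where
  "pair_type2 x y \<longleftrightarrow>
     den x < den y \<and>
     (\<forall>j::int. 1 \<le> j \<and> j \<le> den x \<longrightarrow> \<lfloor>of_int j * x\<rfloor> = \<lfloor>of_int j * y\<rfloor>)"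

definition pair_type3 :: "rat \<Rightarrow> rat \<Rightarrow> bool" where
  "pair_type3 x y \<longleftrightarrow>
     den x > den y \<and>
     (\<forall>j::int. 1 \<le> j \<and> j < den y \<longrightarrow> \<lfloor>of_int j * x\<rfloor> = \<lfloor>of_int j * y\<rfloor>) \<and>
     \<lfloor>of_int (den y) * x\<rfloor> < \<lfloor>of_int (den y) * y\<rfloor>"

end

theory Submission
  imports Defs
begin

text \<open>
Write \<open>[w]\<close> for the value of the continued fraction whose partial quotients are the letters of \<open>w\<close>,
\<open>\<phi>\<close> for the substitution \<open>\<phi>\<^bsub>a,a+1\<^esub>\<close>, and \<open>U(x)\<close> for the upper mechanical word, which has letters
\<open>\<lceil>nx\<rceil> - \<lceil>(n-1)x\<rceil>\<close> where \<open>G(x)\<close> has floors. Everything rests on the closed formula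

  \<open>L([\<phi>(G(x))]) = 1 / [\<phi>(U(x))] + [\<phi>(G(x))]\<close>    (\<open>lagrange_const_mechanical\<close>).

It comes from Perron's formula \<open>lagrange_const_eq_limsup_perron\<close>: the Lagrange constant is the
upper limit, over all positions, of a term read to the right plus a term read to the left. Since
\<open>\<phi>\<close> doubles every letter, \<open>[\<phi>(w)]\<close> decreases when \<open>w\<close> increases lexicographically
(\<open>word_value_antimono\<close>). Every word read in either direction from a position of the mechanical word
lies between \<open>G(x)\<close> and \<open>U(x)\<close>, because its partial sums lie between \<open>\<lfloor>nx\<rfloor>\<close> and \<open>\<lceil>nx\<rceil>\<close>
(\<open>mechanical_extremal\<close>). One of the two terms is the reciprocal of such a value and the other is such
a value, so each position contributes at most the right-hand side up to an error that vanishes, and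
at the ends of the periods the right-hand side is approached.

From \<open>x\<close> to \<open>y\<close> both words increase, so the first summand grows and the second one shrinks; the three
types decide which change is larger. For \<open>0 < x < 1\<close> the words \<open>G(x)\<close> and \<open>U(x)\<close> start with different
letters, \<open>0\<close> and \<open>1\<close>, and then agree up to the end of the first period, where \<open>G(x)\<close> has a \<open>1\<close> and \<open>U(x)\<close> a \<open>0\<close>.

\<^item> Type (1): the lower words \<open>G(x)\<close>, \<open>G(y)\<close> and the upper words \<open>U(x)\<close>, \<open>U(y)\<close> first differ at the
  same position, after \<open>0c\<close> and \<open>1c\<close> with the same \<open>c\<close>. The leading letter 0 of the lower words
  divides their difference by about \<open>(a\<^sup>2 + 1)\<^sup>2\<close>, while the reciprocal of a word starting with \<open>1\<close> only
  loses about \<open>(a + 1)\<^sup>2\<close>. For \<open>a \<ge> 2\<close> the upper words win (\<open>comparison_same_position\<close>).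
\<^item> Type (2): the upper words differ at the end of the period of \<open>x\<close>, where the lower words still
  agree. At least one more common letter contracts the lower difference, which is decisive even for
  \<open>a = 1\<close> (\<open>comparison_upper_first\<close>).
\<^item> Type (3): the lower words differ at the end of the period of \<open>y\<close>, where the upper words still
  agree. The contraction by the additional common letter \<open>0\<close> outweighs the disadvantage of the lower
  words described for type (1) (\<open>comparison_lower_first\<close>).

The slopes 0 and 1 have constant words and need variants of the last two comparisons with an empty prefix.
The comparisons are made by \<open>blocks_distortion\<close>: a common prefix acts on the tails as a Moebius
map, and such a map distorts ratios of differences only by a factor close to 1.
\<close>

section \<open>Convergence of continued fractions\<close>

text \<open>
Leaving the tail of a finite continued fraction as a variable turns convergence and the influence of
distant partial quotients into one question: how much the value reacts to a change of the tail.
\<close>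
definition cf_tail :: "nat list \<Rightarrow> real \<Rightarrow> real" where
  "cf_tail us s = foldr (\<lambda>k t. 1 / (real k + t)) us s"

lemma cf_tail_simps [simp]:
  "cf_tail [] s = s"
  "cf_tail (k # us) s = 1 / (real k + cf_tail us s)"
  "cf_tail (us @ vs) s = cf_tail us (cf_tail vs s)"
  by (simp_all add: cf_tail_def)

lemma cf_list_eq_cf_tail: "cf_list us = cf_tail us 0"
  by (induction us) auto

lemma cf_tail_bounds:
  assumes "set us \<subseteq> {1..}" "0 \<le> s" "s \<le> 1"
  shows "0 \<le> cf_tail us s" "cf_tail us s \<le> 1"
  using assms by (induction us) auto

lemma inverse_add_diff:
  fixes k s t :: real
  assumes "0 < k" "0 \<le> s" "0 \<le> t"
  shows "1 / (k + s) - 1 / (k + t) = (t - s) / ((k + s) * (k + t))"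
proof -
  have "k + s \<noteq> 0" "k + t \<noteq> 0" using assms by linarith+
  then show ?thesis by (simp add: divide_simps)
qed

lemma inverse_add_nonexpansive:
  fixes k s t :: real
  assumes "1 \<le> k" "0 \<le> s" "0 \<le> t"
  shows "\<bar>1 / (k + s) - 1 / (k + t)\<bar> \<le> \<bar>s - t\<bar>"
proof -
  have ge: "1 \<le> (k + s) * (k + t)"
    using mult_mono[of 1 "k + s" 1 "k + t"] assms by simp
  have "\<bar>1 / (k + s) - 1 / (k + t)\<bar> = \<bar>s - t\<bar> / ((k + s) * (k + t))"
    using assms ge by (simp add: inverse_add_diff abs_mult abs_minus_commute)
  also have "\<dots> \<le> \<bar>s - t\<bar> / 1"
    using ge by (intro divide_left_mono) auto
  finally show ?thesis by simp
qed

text \<open>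
Two consecutive steps form a Moebius map of determinant 1 in the tail, whose denominator is
\<open>k l + 1 + k s\<close>.
\<close>
lemma two_step_diff:
  fixes k l s t :: real
  assumes "1 \<le> k" "1 \<le> l" "0 \<le> s" "0 \<le> t"
  shows "1 / (k + 1 / (l + s)) - 1 / (k + 1 / (l + t))
       = (s - t) / ((k * l + 1 + k * s) * (k * l + 1 + k * t))"
proof -
  have nz: "l + s \<noteq> 0" "l + t \<noteq> 0" using assms by auto
  have *: "1 / (k + 1 / (l + u)) = (l + u) / (k * l + 1 + k * u)" if "0 \<le> u" for u
  proof -
    have "l + u \<noteq> 0" using assms that by linarith
    then have "k + 1 / (l + u) = (k * l + 1 + k * u) / (l + u)"
      by (simp add: divide_simps) (simp add: algebra_simps)
    then show ?thesis by simp
  qed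
  have pos: "k * l + 1 + k * u > 0" if "0 \<le> u" for u
    using assms that by (simp add: add_nonneg_pos add_pos_nonneg)
  show ?thesis
    unfolding *[OF assms(3)] *[OF assms(4)]
    using pos[OF assms(3)] pos[OF assms(4)]
    by (simp add: divide_simps) (simp add: algebra_simps)
qed

lemma two_step_contraction:
  fixes k l s t :: real
  assumes "1 \<le> k" "1 \<le> l" "0 \<le> s" "0 \<le> t"
  shows "\<bar>1 / (k + 1 / (l + s)) - 1 / (k + 1 / (l + t))\<bar> \<le> \<bar>s - t\<bar> / 4"
proof -
  have kl: "1 \<le> k * l" using mult_mono[of 1 k 1 l] assms by simp
  have ge: "2 \<le> k * l + 1 + k * u" if "0 \<le> u" for u
    using kl assms that by (simp add: add_increasing2)
  have four: "4 \<le> (k * l + 1 + k * s) * (k * l + 1 + k * t)"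
    using mult_mono[OF ge[OF assms(3)] ge[OF assms(4)]] ge[OF assms(3)] ge[OF assms(4)] by simp
  then have "\<bar>1 / (k + 1 / (l + s)) - 1 / (k + 1 / (l + t))\<bar>
      = \<bar>s - t\<bar> / ((k * l + 1 + k * s) * (k * l + 1 + k * t))"
    unfolding two_step_diff[OF assms] abs_divide by (simp only: abs_of_pos)
  also have "\<dots> \<le> \<bar>s - t\<bar> / 4"
    using four by (intro divide_left_mono) auto
  finally show ?thesis .
qed

text \<open>
A single step with partial quotient 1 need not contract by a uniform factor, but two consecutive
steps contract by 1/4. The factor 2 pays for a possible unpaired step.
\<close>
lemma cf_tail_contraction:
  assumes "set us \<subseteq> {1..}" "0 \<le> s" "s \<le> 1" "0 \<le> t" "t \<le> 1"
  shows "\<bar>cf_tail us s - cf_tail us t\<bar> \<le> 2 * (1/2) ^ length us * \<bar>s - t\<bar>"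
  using assms
proof (induction us rule: induct_list012)
  case (2 k)
  then show ?case using inverse_add_nonexpansive[of "real k" s t] by simp
next
  case (3 k l us)
  have b: "0 \<le> cf_tail us s" "0 \<le> cf_tail us t" using cf_tail_bounds[of us] 3(3-) by auto
  have "\<bar>cf_tail (k # l # us) s - cf_tail (k # l # us) t\<bar> \<le> \<bar>cf_tail us s - cf_tail us t\<bar> / 4"
    using two_step_contraction[of "real k" "real l" "cf_tail us s" "cf_tail us t"] b 3(3-) by simp
  also have "\<dots> \<le> (2 * (1/2) ^ length us * \<bar>s - t\<bar>) / 4"
    using 3 by (intro divide_right_mono) auto
  finally show ?case by (simp add: mult.commute)
qed auto

lemma set_stake_subset: "w \<in> streams A \<Longrightarrow> set (stake n w) \<subseteq> A"
  by (induction n arbitrary: w) (auto simp: streams_shd streams_stl)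

lemma sdrop_streams: "w \<in> streams A \<Longrightarrow> sdrop n w \<in> streams A"
  by (induction n arbitrary: w) (auto simp: streams_stl)

text \<open>
Two long prefixes of \<open>w\<close> differ only in the tail behind their common part, so the values of the
prefixes form a Cauchy sequence by \<open>cf_tail_contraction\<close>.
\<close>
lemma cf_value_LIMSEQ:
  assumes w: "w \<in> streams {1..}"
  shows "(\<lambda>n. cf_list (stake n w)) \<longlonglongrightarrow> cf_value w"
proof -
  let ?X = "\<lambda>n. cf_list (stake n w)"
  have close: "\<bar>?X m - ?X n\<bar> \<le> 2 * (1/2) ^ n" if "n \<le> m" for m n
  proof -
    define t where "t = cf_tail (stake (m - n) (sdrop n w)) 0"
    have t: "0 \<le> t" "t \<le> 1"
      using cf_tail_bounds[OF set_stake_subset[OF sdrop_streams[OF w]]] by (auto simp: t_def)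
    have "stake m w = stake n w @ stake (m - n) (sdrop n w)"
      using that by (simp only: stake_add) simp
    then have "\<bar>?X m - ?X n\<bar> = \<bar>cf_tail (stake n w) t - cf_tail (stake n w) 0\<bar>"
      by (simp only: cf_list_eq_cf_tail cf_tail_simps t_def)
    also have "\<dots> \<le> 2 * (1/2) ^ n * \<bar>t - 0\<bar>"
      using cf_tail_contraction[OF set_stake_subset[OF w, of n], of t 0] t by simp
    also have "\<dots> \<le> 2 * (1/2) ^ n * 1" using t by (intro mult_left_mono) auto
    finally show ?thesis by simp
  qed
  have "Cauchy ?X"
  proof (rule CauchyI')
    fix e :: real assume "0 < e"
    then obtain N where N: "(1/2) ^ N < e / 2" using real_arch_pow_inv[of "e/2" "1/2"] by auto
    have "norm (?X m - ?X n) < e" if "N \<le> m" "m < n" for m n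
    proof -
      have "norm (?X m - ?X n) \<le> 2 * (1/2) ^ m" using close[of m n] that by (simp add: abs_minus_commute)
      also have "\<dots> \<le> 2 * (1/2) ^ N" using that by (intro mult_left_mono power_decreasing) auto
      finally show ?thesis using N by simp
    qed
    then show "\<exists>M. \<forall>m\<ge>M. \<forall>n>m. dist (?X m) (?X n) < e" by (auto simp: dist_norm)
  qed
  then show ?thesis
    unfolding cf_value_def by (simp add: Cauchy_convergent_iff convergent_LIMSEQ_iff)
qed

lemma cf_value_bounds:
  assumes w: "w \<in> streams {1..}"
  shows "0 \<le> cf_value w" "cf_value w \<le> 1"
proof -
  have "0 \<le> cf_list (stake n w)" "cf_list (stake n w) \<le> 1" for n
    using cf_tail_bounds[OF set_stake_subset[OF w], of 0] by (auto simp: cf_list_eq_cf_tail)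
  then show "0 \<le> cf_value w" "cf_value w \<le> 1"
    using cf_value_LIMSEQ[OF w] by (auto intro: LIMSEQ_le_const LIMSEQ_le_const2)
qed

lemma cf_value_Stream:
  assumes kw: "k ## w \<in> streams {1..}"
  shows "cf_value (k ## w) = 1 / (real k + cf_value w)"
proof -
  have k: "1 \<le> k" and w: "w \<in> streams {1..}" using kw by (auto simp: streams_Stream)
  have "(\<lambda>n. cf_list (stake (Suc n) (k ## w))) \<longlonglongrightarrow> cf_value (k ## w)"
    using cf_value_LIMSEQ[OF kw] by (rule LIMSEQ_Suc)
  moreover have "real k + cf_value w \<noteq> 0" using k cf_value_bounds[OF w] by linarith
  then have "(\<lambda>n. cf_list (stake (Suc n) (k ## w))) \<longlonglongrightarrow> 1 / (real k + cf_value w)"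
    by (auto intro!: tendsto_intros cf_value_LIMSEQ[OF w])
  ultimately show ?thesis by (rule LIMSEQ_unique)
qed

lemma cf_value_pos:
  assumes w: "w \<in> streams {1..}"
  shows "0 < cf_value w"
proof -
  have "stl w \<in> streams {1..}" "1 \<le> shd w" using w by (auto simp: streams_stl dest: streams_shd)
  then have "0 < real (shd w) + cf_value (stl w)"
    using cf_value_bounds[of "stl w"] by linarith
  then show ?thesis using cf_value_Stream[of "shd w" "stl w"] w by simp
qed

section \<open>Convergents and the Lagrange constant\<close>

text \<open>
The indices are shifted by one against the usual ones: index 0 stands for the formal convergent
\<open>1/0\<close>. The recurrence, the determinant identity and the sign pattern of the errors then hold from the
start without exception.
\<close>
fun cf_den :: "nat stream \<Rightarrow> nat \<Rightarrow> int" where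
  "cf_den w 0 = 0"
| "cf_den w (Suc 0) = 1"
| "cf_den w (Suc (Suc n)) = int (w !! n) * cf_den w (Suc n) + cf_den w n"

fun cf_num :: "nat stream \<Rightarrow> nat \<Rightarrow> int" where
  "cf_num w 0 = 1"
| "cf_num w (Suc 0) = 0"
| "cf_num w (Suc (Suc n)) = int (w !! n) * cf_num w (Suc n) + cf_num w n"

definition cf_err :: "nat stream \<Rightarrow> nat \<Rightarrow> real" where
  "cf_err w n = of_int (cf_den w n) * cf_value w - of_int (cf_num w n)"

lemma snth_ge_1: "w \<in> streams {1..} \<Longrightarrow> 1 \<le> w !! n"
  by (auto dest: snth_in)

lemma cf_den_nonneg: "0 \<le> cf_den w n"
  by (induction w n rule: cf_den.induct) auto

lemma cf_den_pos:
  assumes w: "w \<in> streams {1..}"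
  shows "0 < cf_den w (Suc n)"
proof (induction n)
  case (Suc n)
  then show ?case using snth_ge_1[OF w, of n] cf_den_nonneg[of w n] by (simp add: add_pos_nonneg)
qed auto

lemma cf_den_strict:
  assumes w: "w \<in> streams {1..}"
  shows "cf_den w (Suc (Suc n)) < cf_den w (Suc (Suc (Suc n)))"
proof -
  have "cf_den w (Suc (Suc n)) \<le> int (w !! Suc n) * cf_den w (Suc (Suc n))"
    using snth_ge_1[OF w, of "Suc n"] cf_den_pos[OF w, of "Suc n"] by simp
  then show ?thesis using cf_den_pos[OF w, of n] by simp
qed

lemma cf_num_den_det:
  "cf_num w (Suc n) * cf_den w n - cf_num w n * cf_den w (Suc n) = - ((-1) ^ n)"
proof (induction n)
  case (Suc n)
  then show ?case by (simp add: algebra_simps)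
qed auto

lemma cf_value_sdrop:
  assumes w: "w \<in> streams {1..}"
  shows "1 / cf_value (sdrop n w) = real (w !! n) + cf_value (sdrop (Suc n) w)"
proof -
  have e: "sdrop n w = w !! n ## sdrop (Suc n) w"
    by (metis sdrop_simps stream.collapse)
  have "w !! n ## sdrop (Suc n) w \<in> streams {1..}" using sdrop_streams[OF w, of n] e by simp
  from cf_value_Stream[OF this] show ?thesis by (simp only: e) simp
qed

text \<open>
The errors obey the recurrence of the convergents, and so does a sequence whose consecutive terms have
the ratios \<open>- [0; w\<^sub>n, w\<^sub>n\<^sub>+\<^sub>1, \<dots>]\<close>. In particular the errors alternate in sign.
\<close>
lemma cf_err_Suc:
  assumes w: "w \<in> streams {1..}"
  shows "cf_err w (Suc n) = - cf_value (sdrop n w) * cf_err w n"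
proof (induction n)
  case 0
  then show ?case by (simp add: cf_err_def)
next
  case (Suc n)
  let ?r = "cf_value (sdrop n w)" and ?r' = "cf_value (sdrop (Suc n) w)"
  have r: "?r > 0" using cf_value_pos[OF sdrop_streams[OF w]] .
  have "cf_err w (Suc (Suc n)) = real (w !! n) * cf_err w (Suc n) + cf_err w n"
    by (simp add: cf_err_def algebra_simps)
  also have "cf_err w n = - (cf_err w (Suc n) * (1 / ?r))" using Suc r by simp
  also have "1 / ?r = real (w !! n) + ?r'" by (rule cf_value_sdrop[OF w])
  finally show ?case by (simp add: algebra_simps)
qed

lemma cf_err_nonzero: "w \<in> streams {1..} \<Longrightarrow> cf_err w n \<noteq> 0"
proof (induction n)
  case (Suc n)
  then show ?case using cf_value_pos[OF sdrop_streams, of w n] by (simp add: cf_err_Suc)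
qed (simp add: cf_err_def)

text \<open>
This is the identity \<open>q\<^sub>n \<bar>e\<^sub>n\<^sub>-\<^sub>1\<bar> + q\<^sub>n\<^sub>-\<^sub>1 \<bar>e\<^sub>n\<bar> = 1\<close> for the errors \<open>e\<^sub>n\<close>, with \<open>e\<^sub>n\<^sub>-\<^sub>1\<close> expressed by \<open>e\<^sub>n\<close>.
Dividing by \<open>q\<^sub>n \<bar>e\<^sub>n\<bar>\<close> gives the quantity in Perron's formula.
\<close>
lemma cf_den_abs_err:
  assumes w: "w \<in> streams {1..}"
  shows "\<bar>cf_err w (Suc n)\<bar> * (cf_den w (Suc n) * (1 / cf_value (sdrop n w)) + cf_den w n) = 1"
proof (induction n)
  case 0
  then show ?case using cf_value_pos[OF w] by (simp add: cf_err_def)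
next
  case (Suc n)
  let ?r = "cf_value (sdrop n w)" and ?r' = "cf_value (sdrop (Suc n) w)"
  have r: "?r' > 0" using cf_value_pos[OF sdrop_streams[OF w]] .
  have "\<bar>cf_err w (Suc (Suc n))\<bar> = ?r' * \<bar>cf_err w (Suc n)\<bar>"
    unfolding cf_err_Suc[OF w, of "Suc n"] using r by (simp add: abs_mult del: sdrop.simps)
  then have "\<bar>cf_err w (Suc (Suc n))\<bar> * (cf_den w (Suc (Suc n)) * (1 / ?r') + cf_den w (Suc n))
     = \<bar>cf_err w (Suc n)\<bar> * (cf_den w (Suc (Suc n)) + cf_den w (Suc n) * ?r')"
    using r by (simp add: divide_simps algebra_simps del: sdrop.simps)
  also have "\<dots> = \<bar>cf_err w (Suc n)\<bar> * (cf_den w (Suc n) * (real (w !! n) + ?r') + cf_den w n)"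
    by (simp add: algebra_simps del: sdrop.simps)
  also have "\<dots> = 1" using Suc unfolding cf_value_sdrop[OF w, of n] .
  finally show ?case .
qed

lemma cf_list_rev_stake:
  assumes w: "w \<in> streams {1..}"
  shows "cf_list (rev (stake n w)) = cf_den w n / cf_den w (Suc n)"
proof (induction n)
  case (Suc n)
  have "real_of_int (cf_den w (Suc n)) > 0" using cf_den_pos[OF w, of n] by simp
  then have "real (w !! n) + cf_den w n / cf_den w (Suc n) = cf_den w (Suc (Suc n)) / cf_den w (Suc n)"
    by (simp add: add_divide_distrib)
  then show ?case using Suc by (simp add: stake_Suc del: stake.simps cf_den.simps)
qed auto

text \<open>
The reciprocal of the tail that starts at position \<open>n\<close>, plus the continued fraction read backwards
from position \<open>n\<close>: the letter at \<open>n\<close> together with what lies on both sides of it.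
\<close>
definition perron :: "nat stream \<Rightarrow> nat \<Rightarrow> real" where
  "perron w n = 1 / cf_value (sdrop n w) + cf_list (rev (stake n w))"

lemma perron_eq:
  assumes w: "w \<in> streams {1..}"
  shows "perron w n = 1 / (cf_den w (Suc n) * \<bar>cf_err w (Suc n)\<bar>)"
proof -
  let ?q = "real_of_int (cf_den w (Suc n))"
  have q: "?q > 0" using cf_den_pos[OF w, of n] by simp
  have e: "\<bar>cf_err w (Suc n)\<bar> > 0" using cf_err_nonzero[OF w] by simp
  have "perron w n = (?q * (1 / cf_value (sdrop n w)) + cf_den w n) / ?q"
    unfolding perron_def cf_list_rev_stake[OF w] using q by (simp add: add_divide_distrib)
  also have "?q * (1 / cf_value (sdrop n w)) + cf_den w n = 1 / \<bar>cf_err w (Suc n)\<bar>"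
    using cf_den_abs_err[OF w, of n] e by (simp add: field_simps)
  finally show ?thesis by simp
qed

text \<open>
Two consecutive convergents form a unimodular matrix, so \<open>(q, p)\<close> is an integer combination of them
with coefficients \<open>u\<close> and \<open>v\<close>. As \<open>0 < q\<close> is below the larger denominator, \<open>u\<close> is nonzero and \<open>v\<close> does
not have the same sign. The errors of the two convergents have opposite signs as well, so the two
contributions to \<open>q \<alpha> - p\<close> add up in absolute value, and one of them is at least the error wanted.
\<close>
lemma best_approximation:
  fixes p q :: int
  assumes w: "w \<in> streams {1..}" and q: "0 < q" "q < cf_den w (Suc (Suc n))"
  shows "\<bar>cf_err w (Suc n)\<bar> \<le> \<bar>q * cf_value w - p\<bar>"
proof -
  let ?q = "cf_den w (Suc n)" and ?q' = "cf_den w (Suc (Suc n))"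
  let ?p = "cf_num w (Suc n)" and ?p' = "cf_num w (Suc (Suc n))"
  let ?e = "cf_err w (Suc n)" and ?r = "cf_value (sdrop (Suc n) w)"
  have q0: "0 < ?q" "0 < ?q'" using cf_den_pos[OF w] by blast+
  have r: "0 < ?r" using cf_value_pos[OF sdrop_streams[OF w]] .
  (* the determinant of the two convergents, a unit that inverts the matrix *)
  define \<sigma> :: int where "\<sigma> = (-1) ^ n"
  have s2: "\<sigma> * \<sigma> = 1" by (simp add: \<sigma>_def flip: power_mult_distrib)
  have det: "?p' * ?q - ?p * ?q' = \<sigma>"
    using cf_num_den_det[of w "Suc n"] by (simp add: \<sigma>_def)
  define u v where "u = \<sigma> * (q * ?p' - p * ?q')" and "v = \<sigma> * (p * ?q - q * ?p)"
  have "u * ?q + v * ?q' = \<sigma> * (q * (?p' * ?q - ?p * ?q'))"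
    unfolding u_def v_def by (simp only: algebra_simps)
  then have qq: "q = u * ?q + v * ?q'" unfolding det using s2 by (simp add: algebra_simps)
  have "u * ?p + v * ?p' = \<sigma> * (p * (?p' * ?q - ?p * ?q'))"
    unfolding u_def v_def by (simp only: algebra_simps)
  then have pp: "p = u * ?p + v * ?p'" unfolding det using s2 by (simp add: algebra_simps)
  have "q * cf_value w - p = u * ?e + v * cf_err w (Suc (Suc n))"
    by (subst qq, subst pp) (simp add: cf_err_def algebra_simps del: cf_den.simps cf_num.simps)
  also have "\<dots> = (u - v * ?r) * ?e"
    unfolding cf_err_Suc[OF w, of "Suc n"] by (simp add: algebra_simps)
  finally have dist: "\<bar>q * cf_value w - p\<bar> = \<bar>u - v * ?r\<bar> * \<bar>?e\<bar>" by (simp add: abs_mult)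
  have "1 \<le> \<bar>u - v * ?r\<bar>"
  proof (cases v "0::int" rule: linorder_cases)
    case equal
    then have "0 < u" using qq q q0 by (simp add: zero_less_mult_iff)
    then show ?thesis using equal by simp
  next
    case greater
    have "?q' \<le> v * ?q'" using greater q0 by simp
    then have "u * ?q < 0" using qq q by linarith
    then have "u \<le> -1" using q0 by (simp add: mult_less_0_iff)
    moreover have "0 \<le> v * ?r" using greater r by simp
    ultimately show ?thesis by linarith
  next
    case less
    have "v * ?q' < 0" using less q0 by (simp add: mult_less_0_iff)
    then have "0 < u * ?q" using qq q by linarith
    then have "1 \<le> u" using q0 by (simp add: zero_less_mult_iff)
    moreover have "v * ?r \<le> 0" using less r by (simp add: mult_le_0_iff)
    ultimately show ?thesis by linarith
  qed
  then show ?thesis unfolding dist by (simp add: mult_le_cancel_right1)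
qed

lemma dist_nearest_int_le: "dist_nearest_int t \<le> \<bar>t - of_int p\<bar>"
  unfolding dist_nearest_int_def using round_diff_minimal[of t p] by simp

lemma dist_nearest_int_cf_den:
  assumes w: "w \<in> streams {1..}" and n: "n \<noteq> 0"
  shows "dist_nearest_int (of_int (cf_den w (Suc n)) * cf_value w) = \<bar>cf_err w (Suc n)\<bar>"
proof (rule antisym)
  show "dist_nearest_int (of_int (cf_den w (Suc n)) * cf_value w) \<le> \<bar>cf_err w (Suc n)\<bar>"
    unfolding cf_err_def by (rule dist_nearest_int_le)
  obtain m where "n = Suc m" using n by (cases n) auto
  then show "\<bar>cf_err w (Suc n)\<bar> \<le> dist_nearest_int (of_int (cf_den w (Suc n)) * cf_value w)"
    unfolding dist_nearest_int_def
    using cf_den_pos[OF w, of n] cf_den_strict[OF w, of m] best_approximation[OF w, of "cf_den w (Suc n)" n]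
    by blast
qed

text \<open>
Perron's formula. For \<open>q\<close> between two consecutive denominators of convergents, both factors of
\<open>q dist_nearest_int (q \<alpha>)\<close> are at least those of the smaller of the two denominators. Hence the upper limit over all
\<open>q\<close> equals the one over the denominators of the convergents.
\<close>
theorem lagrange_const_eq_limsup_perron:
  assumes w: "w \<in> streams {1..}"
  shows "lagrange_const (cf_value w) = limsup (\<lambda>n. ereal (perron w n))"
proof (rule antisym)
  let ?f = "\<lambda>q::nat. ereal (1 / (real q * dist_nearest_int (real q * cf_value w)))"
  let ?den = "\<lambda>n. nat (cf_den w (Suc n))"
  have mono: "strict_mono (\<lambda>n. ?den (Suc n))"
    unfolding strict_mono_Suc_iff using cf_den_strict[OF w] cf_den_pos[OF w]
    by (simp add: nat_less_eq_zless cf_den_nonneg del: cf_den.simps)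
  have large: "\<exists>m. q < ?den (Suc m)" for q
    using seq_suble[OF mono, of "Suc q"] Suc_le_lessD by blast
  show "lagrange_const (cf_value w) \<le> limsup (\<lambda>n. ereal (perron w n))"
    unfolding lagrange_const_def limsup_INF_SUP[of "\<lambda>n. ereal (perron w n)"]
  proof (rule INF_greatest, rule Limsup_bounded)
    fix N :: nat
    have "?f q \<le> (SUP m\<in>{N..}. ereal (perron w m))" if q: "?den (Suc N) \<le> q" for q
    proof -
      (* the last convergent whose denominator does not exceed q *)
      define m where "m = (LEAST m. q < ?den (Suc m))"
      have ub: "q < ?den (Suc m)" unfolding m_def by (rule LeastI_ex) (rule large)
      have Nm: "N < m"
      proof (rule ccontr)
        assume "\<not> N < m"
        then have "?den (Suc m) \<le> ?den (Suc N)"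
          using strict_mono_less_eq[OF mono, of m N] by simp
        then show False using ub q by simp
      qed
      then obtain k where k: "m = Suc k" by (cases m) auto
      have lb: "?den m \<le> q"
        using not_less_Least[of k "\<lambda>m. q < ?den (Suc m)"] k by (simp add: m_def)
      have q0: "0 < q" using lb cf_den_pos[OF w, of m] by linarith
      have "int q < cf_den w (Suc (Suc m))" using ub by simp
      then have "\<bar>cf_err w (Suc m)\<bar> \<le> dist_nearest_int (real q * cf_value w)"
        unfolding dist_nearest_int_def
        using best_approximation[OF w, of "int q" m] q0 by simp
      moreover have "of_int (cf_den w (Suc m)) \<le> real q" using lb by linarith
      moreover have "0 < \<bar>cf_err w (Suc m)\<bar>" using cf_err_nonzero[OF w] by simp
      ultimately have "1 / (real q * dist_nearest_int (real q * cf_value w)) \<le> perron w m"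
        unfolding perron_eq[OF w] using cf_den_pos[OF w, of m]
        by (intro divide_left_mono mult_mono mult_pos_pos) auto
      then have "?f q \<le> ereal (perron w m)" by simp
      also have "\<dots> \<le> (SUP m\<in>{N..}. ereal (perron w m))"
        using Nm by (intro SUP_upper) auto
      finally show ?thesis .
    qed
    then show "eventually (\<lambda>q. ?f q \<le> (SUP m\<in>{N..}. ereal (perron w m))) sequentially"
      by (auto simp: eventually_sequentially)
  qed
  have "limsup (\<lambda>n. ereal (perron w n)) = limsup (\<lambda>n. ereal (perron w (n + 1)))"
    by (rule limsup_shift[symmetric])
  also have "(\<lambda>n. ereal (perron w (n + 1))) = ?f \<circ> (\<lambda>n. ?den (Suc n))"
    using dist_nearest_int_cf_den[OF w] cf_den_nonneg
    by (auto simp: fun_eq_iff perron_eq[OF w] simp del: cf_den.simps)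
  also have "limsup \<dots> \<le> limsup ?f" by (rule limsup_subseq_mono[OF mono])
  finally show "limsup (\<lambda>n. ereal (perron w n)) \<le> lagrange_const (cf_value w)"
    unfolding lagrange_const_def .
qed

section \<open>Values of words with doubled letters\<close>

definition partial_quotient :: "nat \<Rightarrow> int \<Rightarrow> nat" where
  "partial_quotient a c = (if c = 0 then a else a + 1)"

text \<open>
A letter of a word contributes two equal partial quotients; \<open>block a c\<close> is the resulting map from the
value of the rest of the word to the value of the word.
\<close>
definition block :: "nat \<Rightarrow> int \<Rightarrow> real \<Rightarrow> real" where
  "block a c s = 1 / (real (partial_quotient a c) + 1 / (real (partial_quotient a c) + s))"

definition blocks :: "nat \<Rightarrow> int list \<Rightarrow> real \<Rightarrow> real" where
  "blocks a cs s = foldr (block a) cs s"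

definition word_value :: "nat \<Rightarrow> int stream \<Rightarrow> real" where
  "word_value a w = cf_value (phi a (a + 1) w)"

lemma blocks_simps [simp]:
  "blocks a [] s = s"
  "blocks a (c # cs) s = block a c (blocks a cs s)"
  "blocks a (cs @ ds) s = blocks a cs (blocks a ds s)"
  by (simp_all add: blocks_def)

lemma partial_quotient_ge: "1 \<le> a \<Longrightarrow> 1 \<le> partial_quotient a c"
  by (simp add: partial_quotient_def)

lemma phi_letter_eq: "phi_letter a (a + 1) c = [partial_quotient a c, partial_quotient a c]"
  by (simp add: phi_letter_def partial_quotient_def)

lemma phi_Stream: "phi a (a + 1) (c ## w) = partial_quotient a c ## partial_quotient a c ## phi a (a + 1) w"
  by (simp add: phi_def phi_letter_eq[simplified])

lemma phi_streams:
  assumes "1 \<le> a"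
  shows "phi a (a + 1) w \<in> streams {1..}"
proof -
  have "phi a (a + 1) w !! n \<in> {1..}" for n
  proof (induction n arbitrary: w rule: less_induct)
    case (less n)
    obtain c v where w: "w = c ## v" by (cases w)
    show ?case
    proof (cases "n < 2")
      case True
      then show ?thesis
        using assms partial_quotient_ge[of a c] unfolding w phi_Stream
        by (auto simp: less_2_cases_iff)
    next
      case False
      then obtain m where "n = Suc (Suc m)" by (metis One_nat_def Suc_1 less_2_cases_iff not0_implies_Suc)
      then show ?thesis using less[of m v] unfolding w phi_Stream by simp
    qed
  qed
  then show ?thesis by (simp add: streams_iff_snth)
qed

lemma word_value_bounds_01:
  assumes "1 \<le> a"
  shows "0 < word_value a w" "word_value a w \<le> 1"
  unfolding word_value_def
  using cf_value_pos[OF phi_streams[OF assms]] cf_value_bounds[OF phi_streams[OF assms]] by auto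

lemma word_value_Stream:
  assumes "1 \<le> a"
  shows "word_value a (c ## w) = block a c (word_value a w)"
proof -
  have "phi a (a + 1) (c ## w) \<in> streams {1..}" by (rule phi_streams[OF assms])
  then show ?thesis
    unfolding word_value_def phi_Stream block_def
    by (simp add: cf_value_Stream streams_Stream)
qed

lemma word_value_shift:
  assumes "1 \<le> a"
  shows "word_value a (cs @- w) = blocks a cs (word_value a w)"
  by (induction cs) (simp_all add: word_value_Stream[OF assms])

lemma block_diff:
  fixes k :: real and c :: int
  assumes "1 \<le> a" "0 \<le> s" "0 \<le> t"
  defines "k \<equiv> real (partial_quotient a c)"
  shows "block a c s - block a c t = (s - t) / ((k\<^sup>2 + 1 + k * s) * (k\<^sup>2 + 1 + k * t))"
  using two_step_diff[of k k s t] partial_quotient_ge[OF assms(1), of c] assms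
  by (simp add: block_def power2_eq_square)

lemma block_bounds_01:
  assumes "1 \<le> a" "0 \<le> s"
  shows "0 < block a c s" "block a c s \<le> 1"
proof -
  have k: "1 \<le> real (partial_quotient a c)" using partial_quotient_ge[OF assms(1), of c] by simp
  then have "0 \<le> 1 / (real (partial_quotient a c) + s)" using assms by simp
  then have *: "1 \<le> real (partial_quotient a c) + 1 / (real (partial_quotient a c) + s)" using k by linarith
  then show "0 < block a c s" "block a c s \<le> 1" unfolding block_def by simp_all
qed

lemma block_strict_mono:
  assumes "1 \<le> a" "0 \<le> s" "s < t"
  shows "block a c s < block a c t"
proof -
  have "0 < (real (partial_quotient a c))\<^sup>2 + 1 + real (partial_quotient a c) * u" if "0 \<le> u" for u
    using that by (intro add_pos_nonneg add_nonneg_pos) auto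
  then have "0 < block a c t - block a c s"
    using assms by (subst block_diff) auto
  then show ?thesis by simp
qed

lemma block_mono: "1 \<le> a \<Longrightarrow> 0 \<le> s \<Longrightarrow> s \<le> t \<Longrightarrow> block a c s \<le> block a c t"
  using block_strict_mono[of a s t c] by (cases "s = t") auto

lemma blocks_nonneg: "1 \<le> a \<Longrightarrow> 0 \<le> s \<Longrightarrow> 0 \<le> blocks a cs s"
  by (induction cs) (auto intro: less_imp_le block_bounds_01 simp del: One_nat_def)

lemma blocks_strict_mono: "1 \<le> a \<Longrightarrow> 0 \<le> s \<Longrightarrow> s < t \<Longrightarrow> blocks a cs s < blocks a cs t"
  by (induction cs) (auto intro: block_strict_mono blocks_nonneg simp del: One_nat_def)

lemma block_contraction:
  assumes "1 \<le> a" "0 \<le> s" "0 \<le> t"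
  shows "\<bar>block a c s - block a c t\<bar> \<le> \<bar>s - t\<bar> / 4"
  unfolding block_def using partial_quotient_ge[OF assms(1), of c] assms
  by (intro two_step_contraction) auto

lemma blocks_contraction:
  assumes "1 \<le> a" "0 \<le> s" "0 \<le> t"
  shows "\<bar>blocks a cs s - blocks a cs t\<bar> \<le> (1/4) ^ length cs * \<bar>s - t\<bar>"
proof (induction cs)
  case (Cons c cs)
  then show ?case
    using block_contraction[OF assms(1) blocks_nonneg[OF assms(1,2)] blocks_nonneg[OF assms(1,3)], of c cs cs]
    by simp
qed auto

section \<open>How differences propagate through a common prefix\<close>

text \<open>
Induction over the prefix, composing Moebius maps of determinant 1. What matters afterwards is
\<open>D \<le> C\<close>, which keeps the denominator \<open>C + D s\<close> nearly constant for nearly equal \<open>s\<close>. It is not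
inductive by itself, because the new denominator also involves \<open>A\<close> and \<open>B\<close>; \<open>B + D \<le> A + C\<close>
repairs that and still holds for the identity map, where \<open>B > A\<close>.
\<close>
lemma blocks_moebius:
  assumes a: "1 \<le> a"
  shows "\<exists>A B C D. 0 \<le> A \<and> 0 \<le> B \<and> 0 \<le> D \<and> D \<le> C \<and> 0 < C \<and> B + D \<le> A + C \<and> B * C - A * D = 1 \<and>
           (\<forall>s\<ge>0. blocks a cs s = (A + B * s) / (C + D * s))"
proof (induction cs)
  case Nil
  show ?case
    by (rule exI[of _ 0], rule exI[of _ 1], rule exI[of _ 1], rule exI[of _ 0]) simp
next
  case (Cons c cs)
  then obtain A B C D :: real where
    h: "0 \<le> A" "0 \<le> B" "0 \<le> D" "D \<le> C" "0 < C" "B + D \<le> A + C" "B * C - A * D = 1"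
    and eq: "\<And>s. 0 \<le> s \<Longrightarrow> blocks a cs s = (A + B * s) / (C + D * s)" by blast
  define k where "k = real (partial_quotient a c)"
  have k: "1 \<le> k" using partial_quotient_ge[OF a, of c] by (simp add: k_def)
  have k2: "k \<le> k\<^sup>2" using k by (simp add: power2_eq_square)
  have kk: "k * (B - A) \<le> k * (C - D)" using h k by (intro mult_left_mono) auto
  have le: "k * (C - D) \<le> k\<^sup>2 * (C - D)" using h k2 by (intro mult_right_mono) auto
  have "block a c (blocks a cs s) = (k * C + A + (k * D + B) * s) / ((k\<^sup>2 + 1) * C + k * A + ((k\<^sup>2 + 1) * D + k * B) * s)"
    if s: "0 \<le> s" for s
  proof -
    have p1: "0 < C + D * s" using h s by (simp add: add_pos_nonneg)
    have p2: "0 < k * C + A + (k * D + B) * s" using h s k by (simp add: add_pos_nonneg)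
    have "k + blocks a cs s = (k * C + A + (k * D + B) * s) / (C + D * s)"
      unfolding eq[OF s] using p1 by (simp add: field_simps)
    then have "k + 1 / (k + blocks a cs s)
        = ((k\<^sup>2 + 1) * C + k * A + ((k\<^sup>2 + 1) * D + k * B) * s) / (k * C + A + (k * D + B) * s)"
      using p2 by (simp add: field_simps power2_eq_square)
    then show ?thesis by (simp add: block_def flip: k_def)
  qed
  moreover have "(k * D + B) * ((k\<^sup>2 + 1) * C + k * A) - (k * C + A) * ((k\<^sup>2 + 1) * D + k * B) = B * C - A * D"
    by (simp add: algebra_simps power2_eq_square)
  moreover have "(k\<^sup>2 + 1) * D + k * B \<le> (k\<^sup>2 + 1) * C + k * A"
    using kk le h by (simp add: algebra_simps)
  moreover have "(k * D + B) + ((k\<^sup>2 + 1) * D + k * B) \<le> (k * C + A) + ((k\<^sup>2 + 1) * C + k * A)"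
  proof -
    have "k * D \<le> k * C" using h k by (intro mult_left_mono) auto
    then show ?thesis using kk le h by (simp add: algebra_simps)
  qed
  moreover have "0 < (k\<^sup>2 + 1) * C + k * A" using h k by (intro add_pos_nonneg mult_pos_pos) auto
  ultimately show ?case using h k
    by (intro exI[of _ "k * C + A"] exI[of _ "k * D + B"] exI[of _ "(k\<^sup>2 + 1) * C + k * A"]
          exI[of _ "(k\<^sup>2 + 1) * D + k * B"]) auto
qed

lemma blocks_diff:
  assumes a: "1 \<le> a"
  shows "\<exists>C D :: real. 0 < C \<and> 0 \<le> D \<and> D \<le> C \<and>
    (\<forall>s\<ge>0. \<forall>t\<ge>0. blocks a cs s - blocks a cs t = (s - t) / ((C + D * s) * (C + D * t)))"
proof -
  obtain A B C D :: real where
    h: "0 \<le> D" "D \<le> C" "0 < C" "B * C - A * D = 1"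
    and eq: "\<And>s. 0 \<le> s \<Longrightarrow> blocks a cs s = (A + B * s) / (C + D * s)"
    using blocks_moebius[OF a, of cs] by blast
  have "blocks a cs s - blocks a cs t = (s - t) / ((C + D * s) * (C + D * t))"
    if "0 \<le> s" "0 \<le> t" for s t
  proof -
    have p: "0 < C + D * s" "0 < C + D * t" using h that by (auto intro: add_pos_nonneg)
    have "blocks a cs s - blocks a cs t
        = ((A + B * s) * (C + D * t) - (A + B * t) * (C + D * s)) / ((C + D * s) * (C + D * t))"
      unfolding eq[OF that(1)] eq[OF that(2)] using p by (simp add: diff_frac_eq)
    also have "(A + B * s) * (C + D * t) - (A + B * t) * (C + D * s) = (B * C - A * D) * (s - t)"
      by (simp add: algebra_simps)
    finally show ?thesis using h by simp
  qed
  then show ?thesis using h by blast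
qed

text \<open>
The difference of two values behind a prefix is the difference of the tails divided by
\<open>(C + D s) (C + D s')\<close>. For tails in \<open>[lo, hi]\<close> two such factors have a ratio of at most
\<open>(1 + hi) / (1 + lo)\<close>, since \<open>D \<le> C\<close>. Hence an inequality between differences of tails
survives any prefix, up to the factor \<open>\<rho>\<^sup>2\<close>.
\<close>
lemma blocks_distortion:
  assumes a: "1 \<le> a" and lo: "0 \<le> lo" and rho: "1 \<le> \<rho>" "1 + hi \<le> \<rho> * (1 + lo)"
    and I: "s \<in> {lo..hi}" "s' \<in> {lo..hi}" "t \<in> {lo..hi}" "t' \<in> {lo..hi}"
    and le: "\<bar>t - t'\<bar> \<le> \<theta> * (s - s')" 
  shows "\<bar>blocks a cs t - blocks a cs t'\<bar> \<le> \<rho>\<^sup>2 * \<theta> * (blocks a cs s - blocks a cs s')"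
proof -
  obtain C D :: real where h: "0 < C" "0 \<le> D" "D \<le> C" and
    eq: "\<And>s t. 0 \<le> s \<Longrightarrow> 0 \<le> t \<Longrightarrow> blocks a cs s - blocks a cs t = (s - t) / ((C + D * s) * (C + D * t))"
    using blocks_diff[OF a, of cs] by blast
  have nn: "0 \<le> s" "0 \<le> s'" "0 \<le> t" "0 \<le> t'" using I lo by auto
  have pos: "0 < C + D * u" if "0 \<le> u" for u using h that by (simp add: add_pos_nonneg)
  have dist: "C + D * u \<le> \<rho> * (C + D * v)" if "u \<in> {lo..hi}" "v \<in> {lo..hi}" for u v
  proof -
    have "D * (hi - \<rho> * lo) \<le> D * (\<rho> - 1)" using h rho by (intro mult_left_mono) (auto simp: algebra_simps)
    also have "\<dots> \<le> C * (\<rho> - 1)" using h rho by (intro mult_right_mono) auto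
    finally have 1: "C + D * hi \<le> \<rho> * (C + D * lo)" by (simp add: algebra_simps)
    have "C + D * u \<le> C + D * hi" using h that by (simp add: mult_left_mono)
    also note 1
    also have "\<rho> * (C + D * lo) \<le> \<rho> * (C + D * v)" using h rho that
      by (intro mult_left_mono add_left_mono) auto
    finally show ?thesis .
  qed
  define X where "X = (C + D * s) * (C + D * s')"
  define Y where "Y = (C + D * t) * (C + D * t')"
  have X: "0 < X" and Y: "0 < Y" unfolding X_def Y_def using pos nn by simp_all
  have "0 \<le> \<rho> * (C + D * t)" using rho pos nn by (intro mult_nonneg_nonneg) (auto intro: less_imp_le)
  then have "X \<le> (\<rho> * (C + D * t)) * (\<rho> * (C + D * t'))"
    unfolding X_def using dist I pos nn by (intro mult_mono) (auto intro: less_imp_le)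
  then have XY: "X \<le> \<rho>\<^sup>2 * Y" by (simp add: Y_def power2_eq_square mult_ac)
  have "\<bar>blocks a cs t - blocks a cs t'\<bar> = \<bar>t - t'\<bar> / Y"
    using eq nn Y by (simp add: abs_divide abs_of_pos flip: Y_def)
  also have "\<dots> \<le> \<theta> * (s - s') / Y" using le Y by (intro divide_right_mono) auto
  also have "\<dots> \<le> \<theta> * (s - s') * (\<rho>\<^sup>2 / X)"
  proof -
    have "1 / Y \<le> \<rho>\<^sup>2 / X" using XY X Y by (simp add: divide_simps)
    moreover have "0 \<le> \<theta> * (s - s')" using le by linarith
    ultimately show ?thesis using mult_left_mono[of "1 / Y" "\<rho>\<^sup>2 / X" "\<theta> * (s - s')"] by simp
  qed
  also have "\<dots> = \<rho>\<^sup>2 * \<theta> * (blocks a cs s - blocks a cs s')"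
    using eq nn by (simp flip: X_def)
  finally show ?thesis .
qed

text \<open>
The last step of each comparison: the leading letters of the lower and the upper words divide the
differences \<open>e\<close> and \<open>d\<close> behind them by different amounts. The factor \<open>\<kappa>\<close> measures this imbalance and
\<open>\<eta>\<close> bounds \<open>\<bar>e\<bar> / d\<close>.
\<close>
lemma quotient_dominance:
  fixes x x' y y' \<kappa> \<eta> d e :: real
  assumes "0 < x" "0 < x'" "0 < \<kappa>" "\<kappa> * x \<le> y" "\<kappa> * x' \<le> y'" "0 < d" "\<bar>e\<bar> \<le> \<eta> * d" "\<eta> < \<kappa>\<^sup>2"
  shows "\<bar>e\<bar> / (y * y') < d / (x * x')"
proof -
  have y: "0 < y" "0 < y'"
    using assms mult_pos_pos[of \<kappa> x] mult_pos_pos[of \<kappa> x'] by linarith+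
  have p: "0 < x * x'" using assms by simp
  have "(\<kappa> * x) * (\<kappa> * x') \<le> y * y'" using assms y by (intro mult_mono) auto
  then have le: "\<kappa>\<^sup>2 * (x * x') \<le> y * y'" by (simp add: power2_eq_square mult_ac)
  have "\<bar>e\<bar> / (y * y') \<le> \<bar>e\<bar> / (\<kappa>\<^sup>2 * (x * x'))"
    using le p assms y by (intro divide_left_mono) auto
  also have "\<dots> < (\<kappa>\<^sup>2 * d) / (\<kappa>\<^sup>2 * (x * x'))"
  proof (rule divide_strict_right_mono)
    have "\<eta> * d < \<kappa>\<^sup>2 * d" using assms by (intro mult_strict_right_mono) auto
    then show "\<bar>e\<bar> < \<kappa>\<^sup>2 * d" using assms by linarith
  qed (use p assms in auto)
  finally show ?thesis using assms by simp
qed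

section \<open>Numerical bounds for values of words\<close>

text \<open>
The values of all words lie in an interval, and words starting with different letters have values
that are a definite gap apart. The bounds are the values of a first letter with the extreme tails
0 and 1.
\<close>
definition value_lo :: "nat \<Rightarrow> real" where "value_lo a = block a 1 0"
definition value_hi :: "nat \<Rightarrow> real" where "value_hi a = block a 0 1"
definition value_gap :: "nat \<Rightarrow> real" where "value_gap a = block a 0 0 - block a 1 1"

lemma word_value_bounds:
  assumes a: "1 \<le> a"
  shows "word_value a w \<in> {value_lo a..value_hi a}"
    and "word_value a (0 ## v) - word_value a (1 ## v') \<ge> value_gap a"
proof -
  have b: "0 \<le> word_value a u" "word_value a u \<le> 1" for u
    using word_value_bounds_01[OF a, of u] by auto
  have le: "block a 1 s \<le> block a 0 s" if "0 \<le> s" for s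
  proof -
    have "1 / (real a + s) \<le> 1" using a that by simp
    moreover have "0 \<le> 1 / (real a + 1 + s)" using that by simp
    ultimately have "real a + 1 / (real a + s) \<le> real a + 1 + 1 / (real a + 1 + s)"
      by linarith
    then show ?thesis using a that unfolding block_def partial_quotient_def
      by (intro divide_left_mono) (auto intro!: mult_pos_pos add_pos_nonneg simp: add_ac)
  qed
  obtain c u where w: "w = c ## u" by (cases w)
  have c: "block a c s = block a 0 s \<or> block a c s = block a 1 s" for s
    by (simp add: block_def partial_quotient_def)
  have "block a c 0 \<le> block a c (word_value a u)" "block a c (word_value a u) \<le> block a c 1"
    using b block_mono[OF a] by auto
  then show "word_value a w \<in> {value_lo a..value_hi a}"
    unfolding w word_value_Stream[OF a] value_lo_def value_hi_def
    using c[of 0] c[of 1] le[of 0] le[of 1] by auto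
  show "word_value a (0 ## v) - word_value a (1 ## v') \<ge> value_gap a"
    unfolding word_value_Stream[OF a] value_gap_def
    using block_mono[OF a, of 0 "word_value a v" 0] block_mono[OF a, of "word_value a v'" 1 1] b by (simp add: diff_mono)
qed

lemma value_lo_eq: "value_lo a = (real a + 1) / ((real a)\<^sup>2 + 2 * real a + 2)"
  and value_hi_eq: "1 \<le> a \<Longrightarrow> value_hi a = (real a + 1) / ((real a)\<^sup>2 + real a + 1)"
proof -
  have p: "real a + 1 > 0" by simp
  then have "real a + 1 + 1 / (real a + 1) = ((real a)\<^sup>2 + 2 * real a + 2) / (real a + 1)"
    by (simp add: field_simps power2_eq_square)
  then show "value_lo a = (real a + 1) / ((real a)\<^sup>2 + 2 * real a + 2)"
    by (simp add: value_lo_def block_def partial_quotient_def add_ac)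
  have "real a + 1 / (real a + 1) = ((real a)\<^sup>2 + real a + 1) / (real a + 1)"
    using p by (simp add: field_simps power2_eq_square)
  then show "value_hi a = (real a + 1) / ((real a)\<^sup>2 + real a + 1)"
    by (simp add: value_hi_def block_def partial_quotient_def)
qed

lemma value_gap_eq:
  assumes "1 \<le> a"
  shows "value_gap a = ((real a)\<^sup>2 + 2 * real a - 2) / (((real a)\<^sup>2 + 1) * ((real a)\<^sup>2 + 3 * real a + 3))"
proof -
  have p: "0 < real a" "0 < real a + 2" "0 < (real a)\<^sup>2 + 1" "0 < (real a)\<^sup>2 + 3 * real a + 3"
    using assms by (auto intro: add_nonneg_pos)
  have "real a + 1 / real a = ((real a)\<^sup>2 + 1) / real a"
    using p by (simp add: field_simps power2_eq_square)
  then have 1: "block a 0 0 = real a / ((real a)\<^sup>2 + 1)" by (simp add: block_def partial_quotient_def)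
  have "real a + 1 + 1 / (real a + 2) = ((real a)\<^sup>2 + 3 * real a + 3) / (real a + 2)"
    using p by (simp add: field_simps power2_eq_square)
  then have 2: "block a 1 1 = (real a + 2) / ((real a)\<^sup>2 + 3 * real a + 3)"
    by (simp add: block_def partial_quotient_def add_ac)
  show ?thesis unfolding value_gap_def 1 2 using p
    by (simp add: diff_frac_eq) (simp add: algebra_simps power2_eq_square)
qed

lemma value_spread_eq:
  assumes "1 \<le> a"
  shows "value_hi a - value_lo a = (real a + 1)\<^sup>2 / (((real a)\<^sup>2 + real a + 1) * ((real a)\<^sup>2 + 2 * real a + 2))"
proof -
  have p: "0 < (real a)\<^sup>2 + real a + 1" "0 < (real a)\<^sup>2 + 2 * real a + 2"
    using assms by (auto intro: add_nonneg_pos)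
  show ?thesis unfolding value_hi_eq[OF assms] value_lo_eq using p
    by (simp add: diff_frac_eq) (simp add: algebra_simps power2_eq_square)
qed

lemma frac_le_fracI:
  fixes x y u v :: real
  assumes "0 < y" "0 < v" "0 \<le> u * y - x * v"
  shows "x / y \<le> u / v"
  using assms by (simp add: divide_simps mult_ac)

text \<open>
These are polynomial inequalities in \<open>a\<close>. Expanded at the smallest admissible value of \<open>a\<close>, the
difference of the two sides has nonnegative coefficients only; the same works for the next two lemmas.
\<close>
lemma value_spread_le_gap:
  assumes "1 \<le> a"
  shows "value_hi a - value_lo a \<le> 4 * value_gap a" and "2 \<le> a \<Longrightarrow> value_hi a - value_lo a \<le> 2 * value_gap a"
proof -
  have p: "0 < ((real a)\<^sup>2 + 1) * ((real a)\<^sup>2 + 3 * real a + 3)"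
      "0 < ((real a)\<^sup>2 + real a + 1) * ((real a)\<^sup>2 + 2 * real a + 2)"
    by (auto intro!: mult_pos_pos add_nonneg_pos)
  obtain c where c: "real a = 1 + c" "0 \<le> c" using assms
    by (metis add.commute diff_add_cancel diff_ge_0_iff_ge of_nat_1 of_nat_mono)
  have "4 * ((real a)\<^sup>2 + 2 * real a - 2) * (((real a)\<^sup>2 + real a + 1) * ((real a)\<^sup>2 + 2 * real a + 2))
      - (real a + 1)\<^sup>2 * (((real a)\<^sup>2 + 1) * ((real a)\<^sup>2 + 3 * real a + 3))
      = 4 + 196 * c + 386 * c^2 + 328 * c^3 + 145 * c^4 + 33 * c^5 + 3 * c^6"
    unfolding c by (simp add: algebra_simps power_numeral_reduce)
  also have "\<dots> \<ge> 0" using c by simp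
  finally show "value_hi a - value_lo a \<le> 4 * value_gap a"
    unfolding value_spread_eq[OF assms] value_gap_eq[OF assms] times_divide_eq_right
    using p by (intro frac_le_fracI)
  assume "2 \<le> a"
  then obtain c where c: "real a = 2 + c" "0 \<le> c"
    by (metis add.commute diff_add_cancel diff_ge_0_iff_ge of_nat_numeral of_nat_mono)
  have "2 * ((real a)\<^sup>2 + 2 * real a - 2) * (((real a)\<^sup>2 + real a + 1) * ((real a)\<^sup>2 + 2 * real a + 2))
      - (real a + 1)\<^sup>2 * (((real a)\<^sup>2 + 1) * ((real a)\<^sup>2 + 3 * real a + 3))
      = 255 + 771 * c + 807 * c^2 + 418 * c^3 + 117 * c^4 + 17 * c^5 + c^6"
    unfolding c by (simp add: algebra_simps power_numeral_reduce)
  also have "\<dots> \<ge> 0" using c by simp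
  finally show "value_hi a - value_lo a \<le> 2 * value_gap a"
    unfolding value_spread_eq[OF assms] value_gap_eq[OF assms] times_divide_eq_right
    using p by (intro frac_le_fracI)
qed

lemma value_distortion:
  assumes "1 \<le> a"
  shows "1 + value_hi a \<le> 6/5 * (1 + value_lo a)" and "2 \<le> a \<Longrightarrow> 1 + value_hi a \<le> 11/10 * (1 + value_lo a)"
proof -
  have p: "0 < (real a)\<^sup>2 + real a + 1" "0 < (real a)\<^sup>2 + 2 * real a + 2"
    by (auto intro: add_nonneg_pos)
  have e: "1 + value_hi a = ((real a)\<^sup>2 + 2 * real a + 2) / ((real a)\<^sup>2 + real a + 1)"
       "1 + value_lo a = ((real a)\<^sup>2 + 3 * real a + 3) / ((real a)\<^sup>2 + 2 * real a + 2)"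
    unfolding value_hi_eq[OF assms] value_lo_eq using p by (simp_all add: field_simps)
  obtain c where c: "real a = 1 + c" "0 \<le> c" using assms
    by (metis add.commute diff_add_cancel diff_ge_0_iff_ge of_nat_1 of_nat_mono)
  have "6/5 * ((real a)\<^sup>2 + 3 * real a + 3) * ((real a)\<^sup>2 + real a + 1) - ((real a)\<^sup>2 + 2 * real a + 2) * ((real a)\<^sup>2 + 2 * real a + 2)
      = (1 + 16 * c + 20 * c^2 + 8 * c^3 + c^4) / 5"
    unfolding c by (simp add: field_simps power_numeral_reduce)
  also have "\<dots> \<ge> 0" using c by simp
  finally show "1 + value_hi a \<le> 6/5 * (1 + value_lo a)"
    unfolding e times_divide_eq_right using p by (intro frac_le_fracI)
  assume "2 \<le> a"
  then obtain c where c: "real a = 2 + c" "0 \<le> c"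
    by (metis add.commute diff_add_cancel diff_ge_0_iff_ge of_nat_numeral of_nat_mono)
  have "11/10 * ((real a)\<^sup>2 + 3 * real a + 3) * ((real a)\<^sup>2 + real a + 1) - ((real a)\<^sup>2 + 2 * real a + 2) * ((real a)\<^sup>2 + 2 * real a + 2)
      = (1 + 54 * c + 45 * c^2 + 12 * c^3 + c^4) / 10"
    unfolding c by (simp add: field_simps power_numeral_reduce)
  also have "\<dots> \<ge> 0" using c by simp
  finally show "1 + value_hi a \<le> 11/10 * (1 + value_lo a)"
    unfolding e times_divide_eq_right using p by (intro frac_le_fracI)
qed

lemma value_expansion:
  assumes "1 \<le> a"
  shows "9/10 * (real a + 1 + value_hi a) \<le> (real a)\<^sup>2 + 1 + real a * value_lo a"
    and "2 \<le> a \<Longrightarrow> 8/5 * (real a + 1 + value_hi a) \<le> (real a)\<^sup>2 + 1 + real a * value_lo a"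
proof -
  let ?P = "(real a)\<^sup>2 + real a + 1" and ?Q = "(real a)\<^sup>2 + 2 * real a + 2"
  have p: "0 < ?P" "0 < ?Q" by (auto intro: add_nonneg_pos)
  have e: "real a + 1 + value_hi a = ((real a + 1) * ?P + (real a + 1)) / ?P"
       "(real a)\<^sup>2 + 1 + real a * value_lo a = (((real a)\<^sup>2 + 1) * ?Q + real a * (real a + 1)) / ?Q"
    unfolding value_hi_eq[OF assms] value_lo_eq using p by (simp_all add: field_simps)
  obtain c where c: "real a = 1 + c" "0 \<le> c" using assms
    by (metis add.commute diff_add_cancel diff_ge_0_iff_ge of_nat_1 of_nat_mono)
  have "(((real a)\<^sup>2 + 1) * ?Q + real a * (real a + 1)) * ?P - 9/10 * ((real a + 1) * ?P + (real a + 1)) * ?Q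
      = (252 * c + 573 * c^2 + 555 * c^3 + 289 * c^4 + 81 * c^5 + 10 * c^6) / 10"
    unfolding c by (simp add: field_simps power_numeral_reduce)
  also have "\<dots> \<ge> 0" using c by simp
  finally show "9/10 * (real a + 1 + value_hi a) \<le> (real a)\<^sup>2 + 1 + real a * value_lo a"
    unfolding e times_divide_eq_right using p by (intro frac_le_fracI)
  assume "2 \<le> a"
  then obtain c where c: "real a = 2 + c" "0 \<le> c"
    by (metis add.commute diff_add_cancel diff_ge_0_iff_ge of_nat_numeral of_nat_mono)
  have "(((real a)\<^sup>2 + 1) * ?Q + real a * (real a + 1)) * ?P - 8/5 * ((real a + 1) * ?P + (real a + 1)) * ?Q
      = (40 + 1033 * c + 1619 * c^2 + 1077 * c^3 + 373 * c^4 + 67 * c^5 + 5 * c^6) / 5"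
    unfolding c by (simp add: field_simps power_numeral_reduce)
  also have "\<dots> \<ge> 0" using c by simp
  finally show "8/5 * (real a + 1 + value_hi a) \<le> (real a)\<^sup>2 + 1 + real a * value_lo a"
    unfolding e times_divide_eq_right using p by (intro frac_le_fracI)
qed

section \<open>Lexicographic order of words\<close>

lemma stream_split:
  assumes "1 \<le> n"
  shows "w = w !! 0 ## map (snth w) [1..<n] @- w !! n ## sdrop (Suc n) w"
proof -
  have "stake n w = map (snth w) [0..<n]" by (induction n) (simp_all add: stake_Suc del: stake.simps(2))
  also have "\<dots> = w !! 0 # map (snth w) [1..<n]" using assms by (simp add: upt_conv_Cons)
  finally show ?thesis using id_stake_snth_sdrop[of w n] by (metis shift.simps(2))
qed

lemma value_gap_pos: "1 \<le> a \<Longrightarrow> 0 < value_gap a"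
proof -
  assume a: "1 \<le> a"
  have "1 \<le> (real a)\<^sup>2" using a by simp
  then have "0 < (real a)\<^sup>2 + 2 * real a - 2" using a by linarith
  then show ?thesis unfolding value_gap_eq[OF a]
    by (intro divide_pos_pos mult_pos_pos) (auto intro: add_nonneg_pos)
qed

lemma word_value_less:
  assumes "1 \<le> a"
  shows "word_value a (cs @- 1 ## w') < word_value a (cs @- 0 ## w)"
  unfolding word_value_shift[OF assms]
  using word_value_bounds(2)[OF assms, of w w'] value_gap_pos[OF assms] word_value_bounds_01[OF assms]
  by (intro blocks_strict_mono[OF assms]) (auto intro: less_imp_le)

text \<open>
At the first difference the common partial sums cancel, so there \<open>w\<close> has the letter 0 and \<open>w'\<close> the
letter 1. The even number of partial quotients before this place makes the value decrease.
\<close>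
lemma word_value_antimono:
  assumes a: "1 \<le> a" and w: "w \<in> streams {0, 1}" "w' \<in> streams {0, 1}"
    and le: "\<And>m. (\<Sum>i<m. w !! i) \<le> (\<Sum>i<m. w' !! i)"
  shows "word_value a w' \<le> word_value a w"
proof (cases "w = w'")
  case False
  then obtain i where "w !! i \<noteq> w' !! i" by (metis smap_alt stream.map_ident)
  define n where "n = (LEAST i. w !! i \<noteq> w' !! i)"
  have ne: "w !! n \<noteq> w' !! n" unfolding n_def by (rule LeastI) fact
  have eq: "w !! i = w' !! i" if "i < n" for i using not_less_Least that unfolding n_def by blast
  have "(\<Sum>i<n. w !! i) = (\<Sum>i<n. w' !! i)" using eq by (intro sum.cong) auto
  then have "w !! n \<le> w' !! n" using le[of "Suc n"] by simp
  then have 01: "w !! n = 0" "w' !! n = 1" using ne snth_in[OF w(1), of n] snth_in[OF w(2), of n] by auto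
  have "stake n w = stake n w'" using eq by (intro nth_equalityI) (auto simp: stake_nth)
  then show ?thesis
    using word_value_less[OF a, of "stake n w" "sdrop (Suc n) w'" "sdrop (Suc n) w"]
      id_stake_snth_sdrop[of w n] id_stake_snth_sdrop[of w' n] 01 by (metis less_imp_le)
qed auto

lemma word_value_eqI:
  assumes a: "1 \<le> a" and w: "w \<in> streams {0, 1}" "w' \<in> streams {0, 1}"
    and eq: "\<And>m. (\<Sum>i<m. w !! i) = (\<Sum>i<m. w' !! i)"
  shows "word_value a w = word_value a w'"
  by (rule antisym; rule word_value_antimono[OF a]) (use w eq in auto)

section \<open>Mechanical words\<close>

definition upper_word :: "rat \<Rightarrow> int stream" where
  "upper_word x = smap (\<lambda>n. \<lceil>of_nat n * x\<rceil> - \<lceil>(of_nat n - 1) * x\<rceil>) (fromN 1)"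

text \<open>
The word read to the left from position \<open>k\<close>, continued beyond the start of \<open>G(x)\<close> with the letters
that the defining formula gives at the positions \<open>0, -1, -2, \<dots>\<close>. By \<open>\<lfloor>-t\<rfloor> = -\<lceil>t\<rceil>\<close>, these form the
upper word.
\<close>
definition past_word :: "rat \<Rightarrow> nat \<Rightarrow> int stream" where
  "past_word x k = rev (stake k (G_word x)) @- upper_word x"

lemma fromN_1_snth: "fromN 1 !! i = Suc i"
proof -
  have "(Suc ^^ i) m = i + m" for m by (induction i) auto
  then show ?thesis by simp
qed

lemma G_word_snth: "G_word x !! i = \<lfloor>of_nat (Suc i) * x\<rfloor> - \<lfloor>of_nat i * x\<rfloor>"
  by (simp add: G_word_def G_letter_def fromN_1_snth del: snth_siterate One_nat_def)

lemma upper_word_snth: "upper_word x !! i = \<lceil>of_nat (Suc i) * x\<rceil> - \<lceil>of_nat i * x\<rceil>"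
  by (simp add: upper_word_def fromN_1_snth del: snth_siterate One_nat_def)

lemma past_word_Suc: "past_word x (Suc k) = G_word x !! k ## past_word x k"
  by (simp add: past_word_def stake_Suc del: stake.simps)

lemma sum_sdrop_G_word:
  "(\<Sum>i<m. sdrop k (G_word x) !! i) = \<lfloor>of_nat (k + m) * x\<rfloor> - \<lfloor>of_nat k * x\<rfloor>"
  by (induction m) (simp_all add: sdrop_snth G_word_snth add_ac)

lemma sum_G_word: "(\<Sum>i<m. G_word x !! i) = \<lfloor>of_nat m * x\<rfloor>"
  using sum_sdrop_G_word[where k = 0] by simp

lemma sum_upper_word: "(\<Sum>i<m. upper_word x !! i) = \<lceil>of_nat m * x\<rceil>"
  by (induction m) (simp_all add: upper_word_snth)

lemma sum_past_word:
  "(\<Sum>i<m. past_word x k !! i) = \<lfloor>of_nat k * x\<rfloor> - \<lfloor>(of_nat k - of_nat m) * x\<rfloor>"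
proof (induction k arbitrary: m)
  case 0
  show ?case by (simp add: past_word_def sum_upper_word ceiling_def)
next
  case (Suc k)
  show ?case
  proof (cases m)
    case (Suc l)
    then show ?thesis
      using Suc.IH[of l] by (simp add: past_word_Suc sum.lessThan_Suc_shift G_word_snth del: sum.lessThan_Suc)
  qed simp
qed

lemma floor_diff_bounds:
  fixes u v :: rat
  shows "\<lfloor>v\<rfloor> \<le> \<lfloor>u + v\<rfloor> - \<lfloor>u\<rfloor>" "\<lfloor>u + v\<rfloor> - \<lfloor>u\<rfloor> \<le> \<lceil>v\<rceil>"
proof -
  show "\<lfloor>v\<rfloor> \<le> \<lfloor>u + v\<rfloor> - \<lfloor>u\<rfloor>" using le_floor_add[of u v] by linarith
  have "u + v < of_int (\<lfloor>u\<rfloor> + \<lceil>v\<rceil>) + 1" by (simp, linarith)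
  then show "\<lfloor>u + v\<rfloor> - \<lfloor>u\<rfloor> \<le> \<lceil>v\<rceil>" by linarith
qed

lemma mechanical_words_binary:
  assumes "0 \<le> x" "x \<le> 1"
  shows "G_word x \<in> streams {0, 1}" "upper_word x \<in> streams {0, 1}" "past_word x k \<in> streams {0, 1}"
proof -
  have x: "\<lfloor>x\<rfloor> \<in> {0, 1}" "\<lceil>x\<rceil> \<in> {0, 1}" "\<lfloor>x\<rfloor> \<ge> 0" "\<lceil>x\<rceil> \<le> 1"
    using assms by (auto simp: floor_eq_iff ceiling_eq_iff le_less)
  have fl: "\<lfloor>of_nat (Suc i) * x\<rfloor> - \<lfloor>of_nat i * x\<rfloor> \<in> {0, 1}" (is "?z \<in> _") for i
  proof -
    have "of_nat i * x + x = of_nat (Suc i) * x" by (simp add: algebra_simps)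
    then have "\<lfloor>x\<rfloor> \<le> \<lfloor>of_nat (Suc i) * x\<rfloor> - \<lfloor>of_nat i * x\<rfloor>" "\<lfloor>of_nat (Suc i) * x\<rfloor> - \<lfloor>of_nat i * x\<rfloor> \<le> \<lceil>x\<rceil>"
      using floor_diff_bounds[where u = "of_nat i * x" and v = x] by simp_all
    then have "?z = 0 \<or> ?z = 1" using x(3,4) by linarith
    then show ?thesis by simp
  qed
  have ce: "\<lceil>of_nat (Suc i) * x\<rceil> - \<lceil>of_nat i * x\<rceil> \<in> {0, 1}" (is "?z \<in> _") for i
  proof -
    have "- (of_nat (Suc i) * x) + x = - (of_nat i * x)" by (simp add: algebra_simps)
    then have "\<lfloor>x\<rfloor> \<le> \<lceil>of_nat (Suc i) * x\<rceil> - \<lceil>of_nat i * x\<rceil>" "\<lceil>of_nat (Suc i) * x\<rceil> - \<lceil>of_nat i * x\<rceil> \<le> \<lceil>x\<rceil>"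
      using floor_diff_bounds[where u = "- (of_nat (Suc i) * x)" and v = x] by (simp_all add: ceiling_def)
    then have "?z = 0 \<or> ?z = 1" using x(3,4) by linarith
    then show ?thesis by simp
  qed
  show G: "G_word x \<in> streams {0, 1}" unfolding streams_iff_snth G_word_snth using fl by blast
  show U: "upper_word x \<in> streams {0, 1}" unfolding streams_iff_snth upper_word_snth using ce by blast
  show "past_word x k \<in> streams {0, 1}"
    unfolding past_word_def using set_stake_subset[OF G, of k] U by (intro shift_streams) auto
qed

text \<open>
Read in either direction, \<open>m\<close> consecutive letters of the mechanical word sum up to
\<open>\<lfloor>t + mx\<rfloor> - \<lfloor>t\<rfloor>\<close> for some \<open>t\<close>, which lies between the sums \<open>\<lfloor>mx\<rfloor>\<close> of \<open>G(x)\<close> and \<open>\<lceil>mx\<rceil>\<close> of the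
upper word.
\<close>
lemma mechanical_extremal:
  assumes a: "1 \<le> a" and x: "0 \<le> x" "x \<le> 1"
  shows "word_value a (sdrop k (G_word x)) \<in> {word_value a (upper_word x)..word_value a (G_word x)}"
    and "word_value a (past_word x k) \<in> {word_value a (upper_word x)..word_value a (G_word x)}"
proof -
  note bin = mechanical_words_binary[OF x] sdrop_streams[OF mechanical_words_binary(1)[OF x], of k]
  have 1: "\<lfloor>of_nat m * x\<rfloor> \<le> \<lfloor>of_nat (k + m) * x\<rfloor> - \<lfloor>of_nat k * x\<rfloor>"
    "\<lfloor>of_nat (k + m) * x\<rfloor> - \<lfloor>of_nat k * x\<rfloor> \<le> \<lceil>of_nat m * x\<rceil>" for m
    using floor_diff_bounds[where v = "of_nat m * x" and u = "of_nat k * x"] by (simp_all add: algebra_simps)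
  have 2: "\<lfloor>of_nat m * x\<rfloor> \<le> \<lfloor>of_nat k * x\<rfloor> - \<lfloor>(of_nat k - of_nat m) * x\<rfloor>"
    "\<lfloor>of_nat k * x\<rfloor> - \<lfloor>(of_nat k - of_nat m) * x\<rfloor> \<le> \<lceil>of_nat m * x\<rceil>" for m
    using floor_diff_bounds[where v = "of_nat m * x" and u = "(of_nat k - of_nat m) * x"] by (simp_all add: algebra_simps)
  show "word_value a (sdrop k (G_word x)) \<in> {word_value a (upper_word x)..word_value a (G_word x)}"
    using bin 1 by (auto intro!: word_value_antimono[OF a] simp only: atLeastAtMost_iff sum_G_word sum_upper_word sum_sdrop_G_word)
  show "word_value a (past_word x k) \<in> {word_value a (upper_word x)..word_value a (G_word x)}"
    using bin 2 by (auto intro!: word_value_antimono[OF a] simp only: atLeastAtMost_iff sum_G_word sum_upper_word sum_past_word)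
qed

text \<open>
At a multiple of the period both bounds of \<open>mechanical_extremal\<close> are attained at once: to the right
the word starts afresh, to the left the upper word appears.
\<close>
lemma mechanical_periodic:
  assumes a: "1 \<le> a" and x: "0 \<le> x" "x \<le> 1" and k: "of_nat k * x \<in> \<int>"
  shows "word_value a (sdrop k (G_word x)) = word_value a (G_word x)"
    and "word_value a (past_word x k) = word_value a (upper_word x)"
proof -
  note bin = mechanical_words_binary[OF x] sdrop_streams[OF mechanical_words_binary(1)[OF x], of k]
  obtain z where z: "of_nat k * x = of_int z" using k by (auto elim: Ints_cases)
  have s: "of_nat (k + m) * x = of_int z + of_nat m * x"
    "(of_nat k - of_nat m) * x = of_int z + - (of_nat m * x)" for m
    using z by (simp_all add: algebra_simps)
  have fl: "\<lfloor>of_int z + u\<rfloor> = z + \<lfloor>u\<rfloor>" for u :: rat by simp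
  have "(\<Sum>i<m. sdrop k (G_word x) !! i) = (\<Sum>i<m. G_word x !! i)" for m
    unfolding sum_G_word sum_sdrop_G_word s z fl by simp
  then show "word_value a (sdrop k (G_word x)) = word_value a (G_word x)"
    using bin by (intro word_value_eqI[OF a])
  have "(\<Sum>i<m. past_word x k !! i) = (\<Sum>i<m. upper_word x !! i)" for m
    unfolding sum_upper_word sum_past_word s z fl ceiling_def by simp
  then show "word_value a (past_word x k) = word_value a (upper_word x)"
    using bin by (intro word_value_eqI[OF a])
qed

section \<open>The Lagrange constant of a mechanical word\<close>

lemma phi_snth:
  "phi a (a + 1) w !! (2 * k) = partial_quotient a (w !! k)"
  "phi a (a + 1) w !! Suc (2 * k) = partial_quotient a (w !! k)"
proof (induction k arbitrary: w)
  case 0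
  case 1 show ?case by (cases w) (simp add: phi_Stream[simplified])
  case 2 show ?case by (cases w) (simp add: phi_Stream[simplified])
next
  case (Suc k)
  case 1 show ?case using Suc(1)[of "stl w"] by (cases w) (simp add: phi_Stream[simplified])
  case 2 show ?case using Suc(2)[of "stl w"] by (cases w) (simp add: phi_Stream[simplified])
qed

lemma sdrop_phi: "sdrop (2 * k) (phi a (a + 1) w) = phi a (a + 1) (sdrop k w)"
proof (induction k arbitrary: w)
  case (Suc k)
  show ?case using Suc[of "stl w"] by (cases w) (simp add: phi_Stream[simplified])
qed simp

lemma cf_list_rev_stake_phi:
  "cf_list (rev (stake (2 * k) (phi a (a + 1) w))) = blocks a (rev (stake k w)) 0"
proof (induction k)
  case (Suc k)
  have "2 * Suc k = Suc (Suc (2 * k))" by simp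
  then show ?case using Suc phi_snth[of a w k]
    by (simp add: stake_Suc block_def del: stake.simps)
qed simp

text \<open>
A letter gives two positions. At the first one, the tail to the right starts with a whole letter; at
the second one, the term read to the left does, after the partial quotient in the middle has been
moved to it.
\<close>
lemma perron_phi:
  assumes a: "1 \<le> a"
  shows "perron (phi a (a + 1) w) (2 * k) = 1 / word_value a (sdrop k w) + blocks a (rev (stake k w)) 0"
    and "perron (phi a (a + 1) w) (Suc (2 * k)) = word_value a (sdrop (Suc k) w)
      + (partial_quotient a (w !! k) + 1 / (partial_quotient a (w !! k) + blocks a (rev (stake k w)) 0))"
proof -
  let ?p = "phi a (a + 1) w"
  show "perron ?p (2 * k) = 1 / word_value a (sdrop k w) + blocks a (rev (stake k w)) 0"
    by (simp only: perron_def sdrop_phi cf_list_rev_stake_phi word_value_def)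
  have "1 / cf_value (sdrop (Suc (2 * k)) ?p) = partial_quotient a (w !! k) + cf_value (sdrop (2 * Suc k) ?p)"
    unfolding cf_value_sdrop[OF phi_streams[OF a]] phi_snth by (simp add: mult_2)
  moreover have "cf_list (rev (stake (Suc (2 * k)) ?p)) = 1 / (partial_quotient a (w !! k) + blocks a (rev (stake k w)) 0)"
    using phi_snth(1)[of a w k] cf_list_rev_stake_phi[of k a w]
    by (simp add: stake_Suc del: stake.simps)
  ultimately show "perron ?p (Suc (2 * k)) = word_value a (sdrop (Suc k) w)
      + (partial_quotient a (w !! k) + 1 / (partial_quotient a (w !! k) + blocks a (rev (stake k w)) 0))"
    by (simp only: perron_def sdrop_phi word_value_def)
qed

lemma limsup_eqI_subseq:
  fixes X e :: "nat \<Rightarrow> real" and r :: "nat \<Rightarrow> nat"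
  assumes e: "e \<longlonglongrightarrow> 0" and ub: "\<And>n. X n \<le> c + e n"
    and r: "strict_mono r" and lb: "\<And>j. c - e (r j) \<le> X (r j)"
  shows "limsup (\<lambda>n. ereal (X n)) = ereal c"
proof (rule antisym)
  have "(\<lambda>n. ereal (c + e n)) \<longlonglongrightarrow> ereal (c + 0)" using e by (intro tendsto_intros)
  then have "limsup (\<lambda>n. ereal (c + e n)) = ereal c" by (simp add: lim_imp_Limsup)
  then show "limsup (\<lambda>n. ereal (X n)) \<le> ereal c"
    using Limsup_mono[of "\<lambda>n. ereal (X n)" "\<lambda>n. ereal (c + e n)" sequentially] ub by simp
  have "(\<lambda>j. ereal (c - (e \<circ> r) j)) \<longlonglongrightarrow> ereal (c - 0)"
    using LIMSEQ_subseq_LIMSEQ[OF e r] by (intro tendsto_intros)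
  then have "ereal c = limsup (\<lambda>j. ereal (c - e (r j)))"
    using lim_imp_Limsup[of sequentially "\<lambda>j. ereal (c - e (r j))" "ereal c"] by simp
  also have "\<dots> \<le> limsup ((\<lambda>n. ereal (X n)) \<circ> r)"
    using lb by (intro Limsup_mono) (simp add: eventuallyI)
  also have "\<dots> \<le> limsup (\<lambda>n. ereal (X n))" by (rule limsup_subseq_mono[OF r])
  finally show "ereal c \<le> limsup (\<lambda>n. ereal (X n))" .
qed

lemma den_pos: "0 < den x"
  unfolding den_def using quotient_of_denom_pos' .

lemma den_mult_Ints: "of_int (j * den x) * x \<in> \<int>"
proof -
  have "x = of_int (fst (quotient_of x)) / of_int (den x)"
    unfolding den_def by (rule quotient_of_div) simp
  then have "of_int (den x) * x = of_int (fst (quotient_of x))"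
    using den_pos[of x] by (metis less_irrefl nonzero_mult_div_cancel_left of_int_eq_0_iff times_divide_eq_right)
  then have "of_int (j * den x) * x = of_int (j * fst (quotient_of x))" by (simp add: mult.assoc)
  then show ?thesis by (metis Ints_of_int)
qed

text \<open>
By \<open>perron_phi\<close> every position contributes the reciprocal of the value of one word and the value of
another one, one of them read to the right and the other one to the left. Both are bounded by
\<open>mechanical_extremal\<close>, and by \<open>mechanical_periodic\<close> the bound is approached at the ends of the periods.
The word read to the left is actually finite, which costs an error that decays geometrically.
\<close>
theorem lagrange_const_mechanical:
  assumes a: "1 \<le> a" and x: "0 \<le> x" "x \<le> 1"
  shows "lagrange_const (cf_value (phi a (a + 1) (G_word x)))
       = ereal (1 / word_value a (upper_word x) + word_value a (G_word x))"
proof -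
  let ?G = "G_word x" and ?U = "upper_word x"
  let ?V = "word_value a"
  define L where "L = 1 / ?V ?U + ?V ?G"
  define pq where "pq k = real (partial_quotient a (?G !! k))" for k
  define B where "B k = blocks a (rev (stake k ?G)) 0" for k
  have pq: "1 \<le> pq k" for k using partial_quotient_ge[OF a] by (simp add: pq_def)
  have V: "0 < ?V w" "?V w \<le> 1" for w using word_value_bounds_01[OF a] by auto
  have B0: "0 \<le> B k" for k unfolding B_def by (rule blocks_nonneg[OF a]) simp
  have close: "\<bar>B k - ?V (past_word x k)\<bar> \<le> (1/4) ^ k" for k
  proof -
    have "\<bar>B k - ?V (past_word x k)\<bar> \<le> (1/4) ^ k * \<bar>0 - ?V ?U\<bar>"
      using blocks_contraction[OF a, of 0 "?V ?U" "rev (stake k ?G)"] V[of ?U]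
      by (simp add: B_def past_word_def word_value_shift[OF a])
    also have "\<dots> \<le> (1/4) ^ k * 1" using V[of ?U] by (intro mult_left_mono) auto
    finally show ?thesis by simp
  qed
  have past: "1 / ?V (past_word x (Suc k)) = pq k + 1 / (pq k + ?V (past_word x k))" for k
    by (simp add: past_word_Suc word_value_Stream[OF a] block_def pq_def)
  have close': "\<bar>(pq k + 1 / (pq k + B k)) - 1 / ?V (past_word x (Suc k))\<bar> \<le> (1/4) ^ k" for k
    using inverse_add_nonexpansive[OF pq[of k] B0[of k], of "?V (past_word x k)"] close[of k] V[of "past_word x k"]
    unfolding past by linarith
  have ext: "?V ?U \<le> ?V (sdrop k ?G)" "?V (sdrop k ?G) \<le> ?V ?G"
    "?V ?U \<le> ?V (past_word x k)" "?V (past_word x k) \<le> ?V ?G" for k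
    using mechanical_extremal[OF a x, of k] by auto
  have inv: "1 / ?V w \<le> 1 / ?V ?U" if "?V ?U \<le> ?V w" for w
    using that V by (intro divide_left_mono) auto
  let ?P = "perron (phi a (a + 1) ?G)"
  let ?e = "\<lambda>n. (1/4) ^ (n div 2) :: real"
  have P: "?P (2 * k) = 1 / ?V (sdrop k ?G) + B k"
     "?P (Suc (2 * k)) = ?V (sdrop (Suc k) ?G) + (pq k + 1 / (pq k + B k))" for k
    using perron_phi[OF a, of ?G k] by (simp_all only: B_def pq_def)
  have ub: "?P n \<le> L + ?e n" for n
  proof (cases "even n")
    case True
    then obtain k where n: "n = 2 * k" by blast
    have "1 / ?V (sdrop k ?G) + B k \<le> L + (1/4) ^ k"
      using close[of k] ext(4)[of k] inv[OF ext(1)[of k]] unfolding L_def by linarith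
    then show ?thesis unfolding n P by simp
  next
    case False
    then obtain k where n: "n = Suc (2 * k)" by (auto elim!: oddE)
    have "?V (sdrop (Suc k) ?G) + (pq k + 1 / (pq k + B k)) \<le> L + (1/4) ^ k"
      using close'[of k] ext(2)[of "Suc k"] inv[OF ext(3)[of "Suc k"]] unfolding L_def by linarith
    then show ?thesis unfolding n P by simp
  qed
  define d where "d = nat (den x)"
  have d: "0 < d" using den_pos[of x] by (simp add: d_def)
  (* the second position of the last letter of the (j+1)-st period *)
  define r where "r j = Suc (2 * (Suc j * d - 1))" for j
  have r: "strict_mono r" unfolding strict_mono_Suc_iff r_def using d by auto
  have lb: "L - ?e (r j) \<le> ?P (r j)" for j
  proof -
    define k where "k = Suc j * d - 1"
    have Sk: "Suc k = Suc j * d" unfolding k_def using d by simp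
    have "of_nat (Suc k) * x = of_int (int (Suc j) * den x) * x"
      unfolding Sk d_def using den_pos[of x] by (simp add: algebra_simps)
    then have "of_nat (Suc k) * x \<in> \<int>" using den_mult_Ints[of "int (Suc j)" x] by (simp only:)
    note per = mechanical_periodic[OF a x this]
    have "r j div 2 = k" by (simp add: r_def k_def)
    moreover have "?P (r j) = ?V ?G + (pq k + 1 / (pq k + B k))"
      using P(2)[of k] per(1) by (simp add: r_def k_def)
    moreover have "L - (1/4) ^ k \<le> ?V ?G + (pq k + 1 / (pq k + B k))"
      using close'[of k] unfolding per(2) L_def by linarith
    ultimately show ?thesis by simp
  qed
  have "?e \<longlonglongrightarrow> 0"
  proof -
    have "filterlim (\<lambda>n::nat. n div 2) sequentially sequentially"
      by (rule filterlim_at_top_div_const_nat) simp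
    then show ?thesis
      using filterlim_compose[OF LIMSEQ_realpow_zero[of "1/4::real"]] by simp
  qed
  from limsup_eqI_subseq[OF this ub r lb]
  show ?thesis unfolding lagrange_const_eq_limsup_perron[OF phi_streams[OF a]] L_def .
qed

section \<open>Lower words against upper words\<close>

lemma inverse_word_value_1_diff:
  assumes a: "1 \<le> a"
  shows "1 / word_value a (1 ## w') - 1 / word_value a (1 ## w)
       = (word_value a w - word_value a w') / ((real a + 1 + word_value a w') * (real a + 1 + word_value a w))"
proof -
  have V: "0 \<le> word_value a u" for u using word_value_bounds_01[OF a, of u] by simp
  have "1 / word_value a (1 ## u) = real a + 1 + 1 / (real a + 1 + word_value a u)" for u
    by (simp add: word_value_Stream[OF a] block_def partial_quotient_def add_ac)
  then show ?thesis
    using inverse_add_diff[of "real a + 1" "word_value a w'" "word_value a w"] V by simp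
qed

lemma word_value_0_diff:
  assumes a: "1 \<le> a"
  shows "word_value a (0 ## w) - word_value a (0 ## w') = (word_value a w - word_value a w') /
    (((real a)\<^sup>2 + 1 + a * word_value a w) * ((real a)\<^sup>2 + 1 + a * word_value a w'))"
  using block_diff[OF a, of "word_value a w" "word_value a w'" 0] word_value_bounds_01[OF a]
  by (simp add: word_value_Stream[OF a] partial_quotient_def less_imp_le)

text \<open>
Words with the same first letter are much closer to each other than words with different first
letters; this is what makes a later first difference negligible in types (2) and (3).
\<close>
lemma same_letter_diff:
  fixes c :: int
  assumes a: "1 \<le> a"
  defines "k \<equiv> real (partial_quotient a c)"
  shows "\<bar>word_value a (c ## w) - word_value a (c ## w')\<bar> \<le> (value_hi a - value_lo a) / (k\<^sup>2 + 1)\<^sup>2"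
proof -
  let ?V = "word_value a"
  have V: "0 \<le> ?V u" for u using word_value_bounds_01[OF a, of u] by simp
  have k: "0 \<le> k" by (simp add: k_def)
  have pos: "0 < k\<^sup>2 + 1" by (simp add: add_nonneg_pos)
  have ge: "k\<^sup>2 + 1 \<le> k\<^sup>2 + 1 + k * ?V u" for u using k V by simp
  have ge2: "(k\<^sup>2 + 1)\<^sup>2 \<le> (k\<^sup>2 + 1 + k * ?V w) * (k\<^sup>2 + 1 + k * ?V w')"
    unfolding power2_eq_square[of "k\<^sup>2 + 1"] using ge pos by (intro mult_mono) (auto intro: order_trans[OF less_imp_le])
  have p: "0 < (k\<^sup>2 + 1)\<^sup>2" using pos by simp
  have "\<bar>?V (c ## w) - ?V (c ## w')\<bar> = \<bar>?V w - ?V w'\<bar> / ((k\<^sup>2 + 1 + k * ?V w) * (k\<^sup>2 + 1 + k * ?V w'))"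
    using ge2 p unfolding word_value_Stream[OF a] block_diff[OF a V V] k_def[symmetric] abs_divide
    by (simp only: abs_of_pos)
  also have "\<dots> \<le> \<bar>?V w - ?V w'\<bar> / (k\<^sup>2 + 1)\<^sup>2"
    using ge2 by (rule divide_left_mono) (rule abs_ge_zero, rule mult_pos_pos[OF less_le_trans[OF p ge2] p])
  also have "\<dots> \<le> (value_hi a - value_lo a) / (k\<^sup>2 + 1)\<^sup>2"
    using word_value_bounds(1)[OF a, of w] word_value_bounds(1)[OF a, of w'] p
    by (intro divide_right_mono) auto
  finally show ?thesis .
qed

lemma prefix_comparison:
  assumes a: "1 \<le> a" and rho: "1 \<le> \<rho>" "1 + value_hi a \<le> \<rho> * (1 + value_lo a)"
    and le: "\<bar>word_value a q - word_value a q'\<bar> \<le> \<theta> * value_gap a" and "0 \<le> \<theta>"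
  shows "\<bar>word_value a (cs @- q) - word_value a (cs @- q')\<bar>
    \<le> \<rho>\<^sup>2 * \<theta> * (word_value a (cs @- 0 ## v) - word_value a (cs @- 1 ## v'))"
proof -
  have "\<theta> * value_gap a \<le> \<theta> * (word_value a (0 ## v) - word_value a (1 ## v'))"
    using word_value_bounds(2)[OF a] \<open>0 \<le> \<theta>\<close> by (intro mult_left_mono) auto
  then have "\<bar>word_value a q - word_value a q'\<bar> \<le> \<theta> * (word_value a (0 ## v) - word_value a (1 ## v'))"
    using le by linarith
  moreover have "0 \<le> value_lo a" by (simp add: value_lo_eq)
  ultimately show ?thesis
    unfolding word_value_shift[OF a] using word_value_bounds(1)[OF a] rho
    by (intro blocks_distortion[OF a, where lo = "value_lo a" and hi = "value_hi a"]) auto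
qed

text \<open>
The two sides are the denominators that arise when a change behind a leading letter is passed on: by
the reciprocal of a value with leading letter 1 on the left, by a value with leading letter 0 on the
right.
\<close>
lemma expansion_bound:
  assumes a: "1 \<le> a" and k: "0 \<le> \<kappa>" "\<kappa> * (real a + 1 + value_hi a) \<le> (real a)\<^sup>2 + 1 + a * value_lo a"
  shows "\<kappa> * (real a + 1 + word_value a w) \<le> (real a)\<^sup>2 + 1 + a * word_value a w'"
proof -
  have "\<kappa> * (real a + 1 + word_value a w) \<le> \<kappa> * (real a + 1 + value_hi a)"
    using word_value_bounds(1)[OF a, of w] k by (intro mult_left_mono) auto
  also have "\<dots> \<le> (real a)\<^sup>2 + 1 + a * value_lo a" by fact
  also have "\<dots> \<le> (real a)\<^sup>2 + 1 + a * word_value a w'"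
    using word_value_bounds(1)[OF a, of w'] by (intro add_left_mono mult_left_mono) auto
  finally show ?thesis .
qed

text \<open>
The upper words \<open>1 cs 0 v\<close> and \<open>1 cs 1 v'\<close> differ right after \<open>cs\<close>, and the lower words have arbitrary
tails \<open>q\<close>, \<open>q'\<close> there. The difference of \<open>q\<close> and \<open>q'\<close> is \<open>\<theta>\<close> gaps, the prefix \<open>cs\<close> distorts by \<open>\<rho>\<^sup>2\<close>,
and the leading letter 0 gains \<open>\<kappa>\<^sup>2\<close> over the reciprocal of the leading letter 1.
\<close>
lemma upper_change_dominates:
  assumes a: "1 \<le> a" and rho: "1 \<le> \<rho>" "1 + value_hi a \<le> \<rho> * (1 + value_lo a)"
    and k: "0 < \<kappa>" "\<kappa> * (real a + 1 + value_hi a) \<le> (real a)\<^sup>2 + 1 + a * value_lo a"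
    and le: "\<bar>word_value a q - word_value a q'\<bar> \<le> \<theta> * value_gap a" and th: "0 \<le> \<theta>" "\<rho>\<^sup>2 * \<theta> < \<kappa>\<^sup>2"
  shows "word_value a (0 ## cs @- q) - word_value a (0 ## cs @- q')
       < 1 / word_value a (1 ## cs @- 1 ## v') - 1 / word_value a (1 ## cs @- 0 ## v)"
proof -
  let ?V = "word_value a"
  have V: "0 < ?V u" for u using word_value_bounds_01[OF a, of u] by simp
  have d: "0 < ?V (cs @- 0 ## v) - ?V (cs @- 1 ## v')" using word_value_less[OF a] by simp
  have y: "0 < (real a)\<^sup>2 + 1 + a * ?V u" for u using V[of u] by (intro add_pos_nonneg add_nonneg_pos) auto
  have "?V (0 ## cs @- q) - ?V (0 ## cs @- q')
      \<le> \<bar>?V (cs @- q) - ?V (cs @- q')\<bar> / (((real a)\<^sup>2 + 1 + a * ?V (cs @- q)) * ((real a)\<^sup>2 + 1 + a * ?V (cs @- q')))"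
    unfolding word_value_0_diff[OF a] using y by (intro divide_right_mono mult_nonneg_nonneg less_imp_le[OF y]) auto
  also have "\<dots> < (?V (cs @- 0 ## v) - ?V (cs @- 1 ## v')) / ((real a + 1 + ?V (cs @- 1 ## v')) * (real a + 1 + ?V (cs @- 0 ## v)))"
    using V k d prefix_comparison[OF a rho le th(1), of cs v v'] th expansion_bound[OF a _ k(2)]
    by (intro quotient_dominance[where \<kappa> = \<kappa> and \<eta> = "\<rho>\<^sup>2 * \<theta>"]) (auto intro: add_nonneg_pos)
  finally show ?thesis unfolding inverse_word_value_1_diff[OF a] .
qed

text \<open>
The constants are fitted to the worst case \<open>a = 2\<close>; there \<open>\<rho>\<^sup>2 \<theta> = 2.42\<close> is just below \<open>\<kappa>\<^sup>2 = 2.56\<close>.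
\<close>
lemma comparison_same_position:
  assumes a: "2 \<le> a"
  shows "word_value a (0 ## cs @- 0 ## u) - word_value a (0 ## cs @- 1 ## u')
       < 1 / word_value a (1 ## cs @- 1 ## v') - 1 / word_value a (1 ## cs @- 0 ## v)"
proof (rule upper_change_dominates[where \<rho> = "11/10" and \<kappa> = "8/5" and \<theta> = 2])
  show a1: "1 \<le> a" using a by simp
  show "\<bar>word_value a (0 ## u) - word_value a (1 ## u')\<bar> \<le> 2 * value_gap a"
    using value_spread_le_gap(2)[OF a1 a] word_value_bounds(1)[OF a1, of "0 ## u"] word_value_bounds(1)[OF a1, of "1 ## u'"]
    by auto
qed (use a value_distortion[of a] value_expansion[of a] in \<open>auto simp: power2_eq_square\<close>)

text \<open>
For \<open>a = 1\<close> the leading letters give no advantage (\<open>\<kappa> < 1\<close>), but the common letter 1 of the lower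
words contracts by at least 25.
\<close>
lemma comparison_upper_first:
  assumes a: "1 \<le> a"
  shows "word_value a (0 ## cs @- 1 ## u) - word_value a (0 ## cs @- 1 ## u')
       < 1 / word_value a (1 ## cs @- 1 ## v') - 1 / word_value a (1 ## cs @- 0 ## v)"
proof (rule upper_change_dominates[where \<rho> = "6/5" and \<kappa> = "9/10" and \<theta> = "4/25"])
  have "2 \<^sup>2 \<le> (real a + 1)\<^sup>2" using a by (intro power_mono) auto
  then have "(5::real)\<^sup>2 \<le> ((real a + 1)\<^sup>2 + 1)\<^sup>2" by (intro power_mono) auto
  then have ge: "25 \<le> ((real a + 1)\<^sup>2 + 1)\<^sup>2" by simp
  have "\<bar>word_value a (1 ## u) - word_value a (1 ## u')\<bar> \<le> (value_hi a - value_lo a) / ((real a + 1)\<^sup>2 + 1)\<^sup>2"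
    using same_letter_diff[OF a, of 1 u u'] by (simp add: partial_quotient_def add_ac)
  also have "\<dots> \<le> 4 * value_gap a / ((real a + 1)\<^sup>2 + 1)\<^sup>2"
    using value_spread_le_gap(1)[OF a] by (intro divide_right_mono) auto
  also have "\<dots> \<le> 4 * value_gap a / 25"
    using ge value_gap_pos[OF a] by (intro divide_left_mono) auto
  finally show "\<bar>word_value a (1 ## u) - word_value a (1 ## u')\<bar> \<le> 4/25 * value_gap a" by simp
qed (use a value_distortion[of a] value_expansion[of a] in \<open>auto simp: power2_eq_square\<close>)

text \<open>
The case of type (2) in which the smaller slope is 0: both of its words are constantly 0, so the upper
words differ at once and the lower words share at least the first letter.
\<close>
lemma comparison_upper_first_zero:
  assumes a: "1 \<le> a"
  shows "word_value a (0 ## u) - word_value a (0 ## u') < 1 / word_value a (1 ## v') - 1 / word_value a (0 ## v)"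
proof -
  let ?s = "word_value a (0 ## v)" and ?t = "word_value a (1 ## v')"
  have t: "0 < ?t" "?t < ?s" "?s \<le> 1"
    using word_value_bounds_01[OF a] word_value_less[OF a, of "[]"] by auto
  have "1\<^sup>2 \<le> (real a)\<^sup>2" using a by (intro power_mono) auto
  then have "(2::real)\<^sup>2 \<le> ((real a)\<^sup>2 + 1)\<^sup>2" by (intro power_mono) auto
  then have ge: "4 \<le> ((real a)\<^sup>2 + 1)\<^sup>2" by simp
  have "word_value a (0 ## u) - word_value a (0 ## u') \<le> (value_hi a - value_lo a) / ((real a)\<^sup>2 + 1)\<^sup>2"
    using same_letter_diff[OF a, of 0 u u'] by (simp add: partial_quotient_def)
  also have "\<dots> \<le> 4 * value_gap a / ((real a)\<^sup>2 + 1)\<^sup>2"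
    using value_spread_le_gap(1)[OF a] by (intro divide_right_mono) auto
  also have "\<dots> \<le> 4 * value_gap a / 4"
    using ge value_gap_pos[OF a] by (intro divide_left_mono) auto
  also have "\<dots> \<le> ?s - ?t" using word_value_bounds(2)[OF a] by simp
  also have "\<dots> < (?s - ?t) / (?t * ?s)"
  proof -
    have "?t * ?s < 1" using mult_left_mono[of ?s 1 ?t] t by linarith
    then have "(?s - ?t) * (?t * ?s) < (?s - ?t) * 1" using t by (intro mult_strict_left_mono) auto
    then show ?thesis using t by (simp add: less_divide_eq)
  qed
  also have "\<dots> = 1 / ?t - 1 / ?s" using t by (simp add: diff_frac_eq)
  finally show ?thesis .
qed

text \<open>
The leading letters work against the lower words by a factor of at most about \<open>a\<^sup>4 / (a + 1)\<^sup>2\<close>, but the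
common letter 0 of the upper words contracts their difference by at least \<open>(a\<^sup>2 + 1)\<^sup>2\<close>.
\<close>
lemma comparison_lower_first:
  assumes a: "2 \<le> a"
  shows "1 / word_value a (1 ## cs @- 0 ## v') - 1 / word_value a (1 ## cs @- 0 ## v)
       < word_value a (0 ## cs @- 0 ## u) - word_value a (0 ## cs @- 1 ## u')"
proof -
  have a1: "1 \<le> a" using a by simp
  let ?V = "word_value a" and ?m = "(real a)\<^sup>2 + 1"
  let ?q = "0 ## v" and ?q' = "0 ## v'"
  (* contraction by the common letter 0, and the spread is at most two gaps *)
  define \<theta> where "\<theta> = 2 / ?m\<^sup>2"
  (* from m + a t <= m + 1 <= 6/5 m and a + 1 + t >= 3, as m >= 5 *)
  define \<kappa> where "\<kappa> = 5 / (2 * ?m)"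
  have V: "0 < ?V w" "?V w \<le> 1" for w using word_value_bounds_01[OF a1, of w] by auto
  have "2\<^sup>2 \<le> (real a)\<^sup>2" using a by (intro power_mono) auto
  then have m: "5 \<le> ?m" by simp
  have "\<bar>?V ?q - ?V ?q'\<bar> \<le> (value_hi a - value_lo a) / ?m\<^sup>2"
    using same_letter_diff[OF a1, of 0 v v'] by (simp add: partial_quotient_def)
  also have "\<dots> \<le> 2 * value_gap a / ?m\<^sup>2"
    using value_spread_le_gap(2)[OF a1 a] by (intro divide_right_mono) auto
  finally have le: "\<bar>?V ?q - ?V ?q'\<bar> \<le> \<theta> * value_gap a" by (simp add: \<theta>_def)
  have d: "0 < ?V (cs @- 0 ## u) - ?V (cs @- 1 ## u')" using word_value_less[OF a1] by simp
  have y: "0 < real a + 1 + ?V w" for w using V(1)[of w] by linarith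
  have x: "0 < ?m + a * ?V w" for w
    using V(1)[of w] m mult_nonneg_nonneg[of "real a" "?V w"] by linarith
  have k: "\<kappa> * (?m + a * ?V w) \<le> real a + 1 + ?V w'" for w w'
  proof -
    have hi: "a * value_hi a \<le> 1"
    proof -
      have "0 < (real a)\<^sup>2 + real a + 1" by (intro add_nonneg_pos) auto
      then show ?thesis unfolding value_hi_eq[OF a1]
        by (simp add: divide_simps) (simp add: algebra_simps power2_eq_square)
    qed
    have "a * ?V w \<le> a * value_hi a"
      using word_value_bounds(1)[OF a1, of w] by (intro mult_left_mono) auto
    then have aV: "a * ?V w \<le> 1" using hi by (rule order_trans)
    have "1 \<le> ?m / 5" using m by simp
    then have "?m + a * ?V w \<le> ?m + ?m / 5" by (intro add_left_mono order_trans[OF aV])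
    also have "\<dots> = 6/5 * ?m" by (simp add: field_simps)
    finally have "\<kappa> * (?m + a * ?V w) \<le> \<kappa> * (6/5 * ?m)" using m by (intro mult_left_mono) (auto simp: \<kappa>_def)
    also have "\<dots> = 3"
    proof -
      have *: "5 / (2 * z) * (6/5 * z) = 3" if "z \<noteq> 0" for z :: real using that by simp
      have "?m \<noteq> 0" using m by linarith
      from *[OF this] show ?thesis unfolding \<kappa>_def .
    qed
    also have "3 \<le> real a + 1 + ?V w'" using a V(1)[of w'] by linarith
    finally show ?thesis .
  qed
  have sq: "(11/10)\<^sup>2 * (2 / z\<^sup>2) < (5 / (2 * z))\<^sup>2" if "0 < z" for z :: real
  proof -
    have "(11/10)\<^sup>2 * (2 / z\<^sup>2) = 121/50 / z\<^sup>2" by (simp add: power_divide)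
    also have "\<dots> < 25/4 / z\<^sup>2" using that by (intro divide_strict_right_mono) auto
    also have "\<dots> = (5 / (2 * z))\<^sup>2" by (simp add: power_divide power_mult_distrib)
    finally show ?thesis .
  qed
  have m0: "0 < ?m" using m by linarith
  have th: "0 \<le> \<theta>" "(11/10)\<^sup>2 * \<theta> < \<kappa>\<^sup>2" "0 < \<kappa>"
    unfolding \<theta>_def \<kappa>_def using m0 by (simp, intro sq m0, simp)
  have rho: "(1::real) \<le> 11/10" "1 + value_hi a \<le> 11/10 * (1 + value_lo a)" using value_distortion(2)[OF a1 a] by simp_all
  have "1 / ?V (1 ## cs @- ?q') - 1 / ?V (1 ## cs @- ?q)
      \<le> \<bar>?V (cs @- ?q) - ?V (cs @- ?q')\<bar> / ((real a + 1 + ?V (cs @- ?q')) * (real a + 1 + ?V (cs @- ?q)))"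
    unfolding inverse_word_value_1_diff[OF a1] by (intro divide_right_mono mult_nonneg_nonneg less_imp_le[OF y]) auto
  also have "\<dots> < (?V (cs @- 0 ## u) - ?V (cs @- 1 ## u')) / ((?m + a * ?V (cs @- 0 ## u)) * (?m + a * ?V (cs @- 1 ## u')))"
    using d x k th prefix_comparison[OF a1 rho le th(1), of cs u u']
    by (intro quotient_dominance[where \<kappa> = \<kappa> and \<eta> = "(11/10)\<^sup>2 * \<theta>"]) auto
  finally show ?thesis unfolding word_value_0_diff[OF a1] .
qed

text \<open>
The case of type (3) in which the larger slope is 1: both of its words are constantly 1, so the lower
words differ at once and the upper words share at least the first letter.
\<close>
lemma comparison_lower_first_one:
  assumes a: "2 \<le> a"
  shows "1 / word_value a (1 ## v') - 1 / word_value a (1 ## v) < word_value a (0 ## u) - word_value a (1 ## u')"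
proof -
  have a1: "1 \<le> a" using a by simp
  let ?V = "word_value a"
  have V: "0 < ?V w" for w using word_value_bounds_01[OF a1, of w] by auto
  have "3 * 3 \<le> (real a + 1 + ?V v') * (real a + 1 + ?V v)"
    using a V[of v] V[of v'] by (intro mult_mono) auto
  then have ge: "9 \<le> (real a + 1 + ?V v') * (real a + 1 + ?V v)" by simp
  have "1 / ?V (1 ## v') - 1 / ?V (1 ## v) \<le> (value_hi a - value_lo a) / ((real a + 1 + ?V v') * (real a + 1 + ?V v))"
    unfolding inverse_word_value_1_diff[OF a1] using ge word_value_bounds(1)[OF a1, of v] word_value_bounds(1)[OF a1, of v']
    by (intro divide_right_mono) auto
  also have "\<dots> \<le> 2 * value_gap a / ((real a + 1 + ?V v') * (real a + 1 + ?V v))"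
    using value_spread_le_gap(2)[OF a1 a] ge by (intro divide_right_mono) auto
  also have "\<dots> \<le> 2 * value_gap a / 9"
    using ge value_gap_pos[OF a1] by (intro divide_left_mono) auto
  also have "\<dots> < value_gap a" using value_gap_pos[OF a1] by simp
  also have "\<dots> \<le> ?V (0 ## u) - ?V (1 ## u')" by (rule word_value_bounds(2)[OF a1])
  finally show ?thesis .
qed

section \<open>Letters of mechanical words of rational slope\<close>

lemma mult_Ints_imp_den_dvd:
  assumes "of_int j * x \<in> \<int>"
  shows "den x dvd j"
proof -
  let ?p = "fst (quotient_of x)"
  have q: "x = of_int ?p / of_int (den x)" unfolding den_def by (rule quotient_of_div) simp
  obtain z where "of_int j * x = of_int z" using assms by (auto elim: Ints_cases)
  then have "of_int j * of_int ?p = (of_int z * of_int (den x) :: rat)"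
    using den_pos[of x] q by (metis less_irrefl nonzero_eq_divide_eq of_int_eq_0_iff times_divide_eq_right)
  then have "j * ?p = z * den x" by (metis of_int_eq_iff of_int_mult)
  then have "den x dvd j * ?p" by simp
  moreover have "coprime (den x) ?p"
    unfolding den_def using quotient_of_coprime[of x "fst (quotient_of x)" "snd (quotient_of x)"]
    by (simp add: coprime_commute)
  ultimately show ?thesis by (simp add: coprime_dvd_mult_left_iff)
qed

lemma ceiling_eq_floor_Suc:
  assumes "0 < m" "int m < den x"
  shows "\<lceil>of_nat m * x\<rceil> = \<lfloor>of_nat m * x\<rfloor> + 1"
proof -
  have "of_nat m * x \<notin> \<int>"
    using mult_Ints_imp_den_dvd[of "int m" x] assms zdvd_not_zless[of "int m" "den x"] by auto
  then show ?thesis by (simp add: ceiling_altdef) (metis Ints_of_int)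
qed

text \<open>
For \<open>0 < n < den x\<close> the number \<open>n x\<close> is not an integer, so its ceiling and floor differ by 1. This
cancels in the difference of consecutive terms.
\<close>
lemma upper_word_eq_G_word:
  assumes "0 < i" "int (Suc i) < den x"
  shows "upper_word x !! i = G_word x !! i"
  unfolding upper_word_snth G_word_snth
  using assms by (simp only: ceiling_eq_floor_Suc[of i] ceiling_eq_floor_Suc[of "Suc i"])

lemma first_letters:
  assumes "0 < x" "x < 1"
  shows "G_word x !! 0 = 0" "upper_word x !! 0 = 1"
  unfolding G_word_snth upper_word_snth using assms by (auto simp: floor_eq_iff ceiling_eq_iff)

lemma den_ge_2: "0 < x \<Longrightarrow> x < 1 \<Longrightarrow> 2 \<le> den x"
proof (rule ccontr)
  assume x: "0 < x" "x < 1" and "\<not> 2 \<le> den x"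
  then have "den x = 1" using den_pos[of x] by linarith
  then have "x \<in> \<int>" using den_mult_Ints[of 1 x] by simp
  then show False using x by (auto elim!: Ints_cases)
qed

lemma period_letters:
  assumes "0 < x" "x < 1" "den x = int (Suc n)"
  shows "G_word x !! n = 1" "upper_word x !! n = 0"
proof -
  have n: "0 < n" using den_ge_2[OF assms(1,2)] assms(3) by simp
  have "of_nat (Suc n) * x \<in> \<int>" using den_mult_Ints[of 1 x] assms(3) by simp
  then obtain z where z: "of_nat (Suc n) * x = of_int z" by (auto elim: Ints_cases)
  have nx: "of_nat n * x = of_int z - x" using z by (simp add: algebra_simps)
  have "\<lfloor>of_nat n * x\<rfloor> = z - 1" unfolding nx using assms by (simp add: floor_eq_iff)
  moreover then have "\<lceil>of_nat n * x\<rceil> = z" using ceiling_eq_floor_Suc[of n x] n assms(3) by simp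
  ultimately show "G_word x !! n = 1" "upper_word x !! n = 0"
    unfolding G_word_snth upper_word_snth z by simp_all
qed

lemma G_word_cong:
  assumes "\<And>j. j \<le> n \<Longrightarrow> \<lfloor>of_nat j * x\<rfloor> = \<lfloor>of_nat j * y\<rfloor>" "i < n"
  shows "G_word x !! i = G_word y !! i"
  unfolding G_word_snth using assms(1)[of i] assms(1)[of "Suc i"] assms(2) by simp

lemma floor_eq_imp_letters:
  assumes x: "0 \<le> x" "x < y" "y \<le> 1" and eq: "\<lfloor>of_nat n * x\<rfloor> = \<lfloor>of_nat n * y\<rfloor>"
    and less: "\<lfloor>of_nat (Suc n) * x\<rfloor> < \<lfloor>of_nat (Suc n) * y\<rfloor>"
  shows "G_word x !! n = 0" "G_word y !! n = 1"
proof -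
  have "G_word x !! n \<in> {0, 1}" "G_word y !! n \<in> {0, 1}"
    using mechanical_words_binary(1)[of x] mechanical_words_binary(1)[of y] x by (auto dest: snth_in)
  moreover have "G_word x !! n < G_word y !! n" unfolding G_word_snth using eq less by simp
  ultimately show "G_word x !! n = 0" "G_word y !! n = 1" by auto
qed

lemma word_decomp:
  assumes "0 < n" "w !! 0 = c" "w !! n = c'" and "\<And>i. 0 < i \<Longrightarrow> i < n \<Longrightarrow> w !! i = f i"
  shows "\<exists>u. w = c ## map f [1..<n] @- c' ## u"
proof -
  have "map (snth w) [1..<n] = map f [1..<n]" using assms(4) by (intro map_cong) auto
  then have "w = c ## map f [1..<n] @- c' ## sdrop (Suc n) w"
    using stream_split[of n w, unfolded assms(2,3)] assms(1) by (simp only: Suc_leI One_nat_def)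
  then show ?thesis by (rule exI)
qed

section \<open>Comparison of two slopes\<close>

text \<open>
The real number that \<open>lagrange_const_mechanical\<close> identifies as the Lagrange constant.
\<close>
definition lagrange_value :: "nat \<Rightarrow> rat \<Rightarrow> real" where
  "lagrange_value a x = 1 / word_value a (upper_word x) + word_value a (G_word x)"

lemma den_obtain_Suc:
  assumes "0 < x" "x < 1"
  shows "\<exists>n. den x = int (Suc n) \<and> 0 < n"
  using den_ge_2[OF assms] by (intro exI[of _ "nat (den x) - 1"]) auto

lemma den_0: "den 0 = 1" and den_1: "den 1 = 1"
  by (simp_all add: den_def)

lemma stream_splitI: "w !! 0 = c \<Longrightarrow> \<exists>u. w = c ## u"
  by (cases w) auto

lemma letters_0: "G_word 0 !! 0 = 0" "upper_word 0 !! 0 = 0"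
  and letters_1: "G_word 1 !! 0 = 1" "upper_word 1 !! 0 = 1"
  unfolding G_word_snth upper_word_snth by simp_all

text \<open>
Here lower and upper words coincide, and \<open>t + 1/t\<close> is strictly decreasing on \<open>(0, 1]\<close>.
\<close>
lemma lagrange_value_0_1:
  assumes a: "1 \<le> a"
  shows "lagrange_value a 0 < lagrange_value a 1"
proof -
  let ?s = "word_value a (G_word 0)" and ?t = "word_value a (G_word 1)"
  have u: "upper_word 0 = G_word 0" "upper_word 1 = G_word 1"
    by (auto simp: upper_word_def G_word_def G_letter_def smap_alt intro!: stream.map_cong)
  obtain w w' where "G_word 0 = 0 ## w" "G_word 1 = 1 ## w'"
    using stream_splitI[OF letters_0(1)] stream_splitI[OF letters_1(1)] by blast
  then have t: "0 < ?t" "?t < ?s" "?s \<le> 1"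
    using word_value_bounds_01[OF a] word_value_less[OF a, of "[]"] by auto
  have "?t * ?s < 1" using mult_left_mono[of ?s 1 ?t] t by linarith
  then have "(?s - ?t) * (?t * ?s) < (?s - ?t) * 1" using t by (intro mult_strict_left_mono) auto
  then have "?s - ?t < (?s - ?t) / (?t * ?s)" using t by (simp add: less_divide_eq)
  also have "\<dots> = 1 / ?t - 1 / ?s" using t by (simp add: diff_frac_eq)
  finally show ?thesis unfolding lagrange_value_def u by linarith
qed

text \<open>
Unless the slopes are 0 and 1, let \<open>m\<close> be the least \<open>n\<close> with \<open>\<lfloor>nx\<rfloor> < \<lfloor>ny\<rfloor>\<close>. It is smaller than both denominators, so lower and upper
words agree at the positions \<open>2, \<dots>, m\<close>, and all four words have the same letters between the first
position and position \<open>m\<close>.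
\<close>
lemma lagrange_value_type1:
  assumes a: "2 \<le> a" and x: "0 \<le> x" "x < y" "y \<le> 1" and ty: "pair_type1 x y"
  shows "lagrange_value a x < lagrange_value a y"
proof (cases "(x, y) = (0, 1)")
  case True
  then show ?thesis using lagrange_value_0_1[of a] a by simp
next
  case False
  then obtain n :: int where n: "0 < n" "n < min (den x) (den y)" "\<lfloor>of_int n * x\<rfloor> < \<lfloor>of_int n * y\<rfloor>"
    using ty unfolding pair_type1_def by blast
  have "x \<noteq> 0" "y \<noteq> 1" using n den_0 den_1 by auto
  then have xy: "0 < x" "x < 1" "0 < y" "y < 1" using x by auto
  define m where "m = (LEAST m. \<lfloor>of_nat m * x\<rfloor> \<noteq> \<lfloor>of_nat m * y\<rfloor>)"
  have ex: "\<lfloor>of_nat (nat n) * x\<rfloor> \<noteq> \<lfloor>of_nat (nat n) * y\<rfloor>" using n by simp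
  have ne: "\<lfloor>of_nat m * x\<rfloor> \<noteq> \<lfloor>of_nat m * y\<rfloor>" unfolding m_def by (rule LeastI) (rule ex)
  have "m \<le> nat n" unfolding m_def by (rule Least_le) (rule ex)
  then have m: "int m < den x" "int m < den y" using n by auto
  have eq: "\<lfloor>of_nat j * x\<rfloor> = \<lfloor>of_nat j * y\<rfloor>" if "j < m" for j
    using not_less_Least that unfolding m_def by blast
  have less: "\<lfloor>of_nat m * x\<rfloor> < \<lfloor>of_nat m * y\<rfloor>"
    using ne floor_mono[of "of_nat m * x" "of_nat m * y"] x by (simp add: mult_left_mono)
  have "\<lfloor>x\<rfloor> = 0" "\<lfloor>y\<rfloor> = 0" using xy by (simp_all add: floor_eq_iff)
  moreover have "m \<noteq> 0" by (rule notI) (use ne in simp)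
  ultimately have "m \<noteq> 0" "m \<noteq> 1" using ne by auto
  then obtain k where k: "m = Suc k" "0 < k" by (cases m) auto
  let ?f = "snth (G_word x)"
  have G: "G_word x !! i = G_word y !! i" if "i < k" for i
    using that k eq by (intro G_word_cong[of k]) auto
  have Gk: "G_word x !! k = 0" "G_word y !! k = 1"
    using floor_eq_imp_letters[OF x, of k] eq[of k] less k by auto
  have U: "upper_word x !! i = G_word x !! i" "upper_word y !! i = G_word y !! i" if "0 < i" "i \<le> k" for i
    using that m k by (auto intro!: upper_word_eq_G_word)
  obtain u where u: "G_word x = 0 ## map ?f [1..<k] @- 0 ## u"
    using word_decomp[of k "G_word x" 0 0 ?f] k Gk first_letters[of x] xy by auto
  obtain u' where u': "G_word y = 0 ## map ?f [1..<k] @- 1 ## u'"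
    using word_decomp[of k "G_word y" 0 1 ?f] k Gk first_letters[of y] xy G by auto
  obtain v where v: "upper_word x = 1 ## map ?f [1..<k] @- 0 ## v"
    using word_decomp[of k "upper_word x" 1 0 ?f] k Gk first_letters[of x] xy U by auto
  obtain v' where v': "upper_word y = 1 ## map ?f [1..<k] @- 1 ## v'"
    using word_decomp[of k "upper_word y" 1 1 ?f] k Gk first_letters[of y] xy G U by auto
  show ?thesis
    using comparison_same_position[OF a, of "map ?f [1..<k]" u u' v' v]
    unfolding lagrange_value_def u[symmetric] u'[symmetric] v[symmetric] v'[symmetric] by linarith
qed

text \<open>
For \<open>x > 0\<close>, at position \<open>den x\<close> the word \<open>U(x)\<close> has the letter 0 while the three others have 1; at the positions
between the first one and this one all four words agree.
\<close>
lemma lagrange_value_type2: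
  assumes a: "1 \<le> a" and x: "0 \<le> x" "x < y" "y \<le> 1" and ty: "pair_type2 x y"
  shows "lagrange_value a x < lagrange_value a y"
proof -
  have den: "den x < den y" and fl: "\<And>j. 1 \<le> j \<Longrightarrow> j \<le> den x \<Longrightarrow> \<lfloor>of_int j * x\<rfloor> = \<lfloor>of_int j * y\<rfloor>"
    using ty unfolding pair_type2_def by blast+
  have "y \<noteq> 1" using den den_pos[of x] den_1 by auto
  then have y: "0 < y" "y < 1" using x by auto
  show ?thesis
  proof (cases "x = 0")
    case True
    obtain u u' v v' where *: "G_word x = 0 ## u" "G_word y = 0 ## u'" "upper_word x = 0 ## v" "upper_word y = 1 ## v'"
      using stream_splitI[OF letters_0(1)] stream_splitI[OF letters_0(2)]
        stream_splitI[OF first_letters(1)[OF y]] stream_splitI[OF first_letters(2)[OF y]]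
      unfolding True by blast
    show ?thesis
      using comparison_upper_first_zero[OF a, of u u' v' v]
      unfolding lagrange_value_def *[symmetric] by linarith
  next
    case False
    then have x': "0 < x" "x < 1" using x y by auto
    obtain n where n: "den x = int (Suc n)" "0 < n"
      using den_obtain_Suc[OF x'] by blast
    have G: "G_word x !! i = G_word y !! i" if "i \<le> n" for i
    proof (rule G_word_cong[of "Suc n"])
      show "\<lfloor>of_nat j * x\<rfloor> = \<lfloor>of_nat j * y\<rfloor>" if "j \<le> Suc n" for j
        using fl[of "int j"] that n by (cases "j = 0") auto
    qed (use that in auto)
    note pl = period_letters[OF x' n(1)]
    have Ux: "upper_word x !! i = G_word x !! i" if "0 < i" "i < n" for i
      using that n by (auto intro!: upper_word_eq_G_word)
    have Uy: "upper_word y !! i = G_word y !! i" if "0 < i" "i \<le> n" for i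
      using that n den by (auto intro!: upper_word_eq_G_word)
    let ?f = "snth (G_word x)"
    obtain u where u: "G_word x = 0 ## map ?f [1..<n] @- 1 ## u"
      using word_decomp[of n "G_word x" 0 1 ?f] n pl first_letters[OF x'] by auto
    obtain u' where u': "G_word y = 0 ## map ?f [1..<n] @- 1 ## u'"
      using word_decomp[of n "G_word y" 0 1 ?f] n pl first_letters[OF y] G by auto
    obtain v where v: "upper_word x = 1 ## map ?f [1..<n] @- 0 ## v"
      using word_decomp[of n "upper_word x" 1 0 ?f] n pl first_letters[OF x'] Ux by auto
    obtain v' where v': "upper_word y = 1 ## map ?f [1..<n] @- 1 ## v'"
      using word_decomp[of n "upper_word y" 1 1 ?f] n pl first_letters[OF y] G Uy by auto
    show ?thesis
      using comparison_upper_first[OF a, of "map ?f [1..<n]" u u' v' v]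
      unfolding lagrange_value_def u[symmetric] u'[symmetric] v[symmetric] v'[symmetric] by linarith
  qed
qed

text \<open>
For \<open>y < 1\<close>, at position \<open>den y\<close> the word \<open>G(y)\<close> has the letter 1 while the three others have 0; at the positions
between the first one and this one all four words agree.
\<close>
lemma lagrange_value_type3:
  assumes a: "2 \<le> a" and x: "0 \<le> x" "x < y" "y \<le> 1" and ty: "pair_type3 x y"
  shows "lagrange_value a y < lagrange_value a x"
proof -
  have den: "den y < den x" and fl: "\<And>j. 1 \<le> j \<Longrightarrow> j < den y \<Longrightarrow> \<lfloor>of_int j * x\<rfloor> = \<lfloor>of_int j * y\<rfloor>"
    and less: "\<lfloor>of_int (den y) * x\<rfloor> < \<lfloor>of_int (den y) * y\<rfloor>"
    using ty unfolding pair_type3_def by blast+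
  have "x \<noteq> 0" using den den_pos[of y] den_0 by auto
  then have x': "0 < x" "x < 1" using x by auto
  show ?thesis
  proof (cases "y = 1")
    case True
    obtain u u' v v' where *: "G_word x = 0 ## u" "G_word y = 1 ## u'" "upper_word x = 1 ## v" "upper_word y = 1 ## v'"
      using stream_splitI[OF letters_1(1)] stream_splitI[OF letters_1(2)]
        stream_splitI[OF first_letters(1)[OF x']] stream_splitI[OF first_letters(2)[OF x']]
      unfolding True by blast
    show ?thesis
      using comparison_lower_first_one[OF a, of v' v u u']
      unfolding lagrange_value_def *[symmetric] by linarith
  next
    case False
    then have y: "0 < y" "y < 1" using x by auto
    obtain n where n: "den y = int (Suc n)" "0 < n"
      using den_obtain_Suc[OF y] by blast
    have fl': "\<lfloor>of_nat j * x\<rfloor> = \<lfloor>of_nat j * y\<rfloor>" if "j \<le> n" for j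
      using fl[of "int j"] that n by (cases "j = 0") auto
    have G: "G_word x !! i = G_word y !! i" if "i < n" for i
      using that fl' by (intro G_word_cong[of n]) auto
    have Gn: "G_word x !! n = 0" "G_word y !! n = 1"
      using floor_eq_imp_letters[OF x, of n] fl'[of n] less n by auto
    note pl = period_letters[OF y n(1)]
    have Ux: "upper_word x !! i = G_word x !! i" if "0 < i" "i \<le> n" for i
      using that n den by (auto intro!: upper_word_eq_G_word)
    have Uy: "upper_word y !! i = G_word y !! i" if "0 < i" "i < n" for i
      using that n by (auto intro!: upper_word_eq_G_word)
    let ?f = "snth (G_word x)"
    obtain u where u: "G_word x = 0 ## map ?f [1..<n] @- 0 ## u"
      using word_decomp[of n "G_word x" 0 0 ?f] n Gn first_letters[OF x'] by auto
    obtain u' where u': "G_word y = 0 ## map ?f [1..<n] @- 1 ## u'"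
      using word_decomp[of n "G_word y" 0 1 ?f] n Gn first_letters[OF y] G by auto
    obtain v where v: "upper_word x = 1 ## map ?f [1..<n] @- 0 ## v"
      using word_decomp[of n "upper_word x" 1 0 ?f] n Gn first_letters[OF x'] Ux by auto
    obtain v' where v': "upper_word y = 1 ## map ?f [1..<n] @- 0 ## v'"
      using word_decomp[of n "upper_word y" 1 0 ?f] n pl first_letters[OF y] G Uy by auto
    show ?thesis
      using comparison_lower_first[OF a, of "map ?f [1..<n]" v' v u u']
      unfolding lagrange_value_def u[symmetric] u'[symmetric] v[symmetric] v'[symmetric] by linarith
  qed
qed

theorem theorem1p5:
  fixes x y :: rat
  assumes "0 \<le> x" and "x < y" and "y \<le> 1"
  shows "(\<forall>a::nat. pair_type1 x y \<and> a \<ge> 2 \<longrightarrow>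
            lagrange_const (cf_value (phi a (a + 1) (G_word x)))
              < lagrange_const (cf_value (phi a (a + 1) (G_word y)))) \<and>
         (\<forall>a::nat. pair_type2 x y \<and> a \<ge> 1 \<longrightarrow>
            lagrange_const (cf_value (phi a (a + 1) (G_word x)))
              < lagrange_const (cf_value (phi a (a + 1) (G_word y)))) \<and>
         (\<forall>a::nat. pair_type3 x y \<and> a \<ge> 2 \<longrightarrow>
            lagrange_const (cf_value (phi a (a + 1) (G_word x)))
              > lagrange_const (cf_value (phi a (a + 1) (G_word y))))"
proof -
  have x: "0 \<le> x" "x \<le> 1" and y: "0 \<le> y" "y \<le> 1" using assms by auto
  have L: "lagrange_const (cf_value (phi a (a + 1) (G_word x))) = ereal (lagrange_value a x)"
    "lagrange_const (cf_value (phi a (a + 1) (G_word y))) = ereal (lagrange_value a y)" if "1 \<le> a" for a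
    unfolding lagrange_value_def
    by (rule lagrange_const_mechanical[OF that x], rule lagrange_const_mechanical[OF that y])
  show ?thesis
  proof (intro conjI allI impI; elim conjE)
    fix a :: nat
    assume "pair_type1 x y" and a: "2 \<le> a"
    moreover have "1 \<le> a" using a by simp
    ultimately show "lagrange_const (cf_value (phi a (a + 1) (G_word x)))
        < lagrange_const (cf_value (phi a (a + 1) (G_word y)))"
      unfolding L[OF \<open>1 \<le> a\<close>] by (simp add: lagrange_value_type1[OF _ assms])
  next
    fix a :: nat
    assume "pair_type2 x y" and a: "1 \<le> a"
    then show "lagrange_const (cf_value (phi a (a + 1) (G_word x)))
        < lagrange_const (cf_value (phi a (a + 1) (G_word y)))"
      unfolding L[OF a] using lagrange_value_type2[OF a assms] by simp
  next
    fix a :: nat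
    assume "pair_type3 x y" and a: "2 \<le> a"
    moreover have "1 \<le> a" using a by simp
    ultimately show "lagrange_const (cf_value (phi a (a + 1) (G_word y)))
        < lagrange_const (cf_value (phi a (a + 1) (G_word x)))"
      unfolding L[OF \<open>1 \<le> a\<close>] by (simp add: lagrange_value_type3[OF _ assms])
  qed
qed

end
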